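(* Let $\Phi\in C^2(0,\infty)$ be a real-valued function and, for each $\lambda>0$, let $$V_\lambda(x)=\frac{x^2}{2}+\lambda\Phi(x),\qquad x\in(0,\infty).$$ Then the family $\{V_\lambda\}_{\lambda>0}$ is $T$-isochronous for some $T>0$ if and only if, up to an additive constant in $\Phi$, there is a constant $K<0$ such that either $$\Phi(x)=Kx \ \text{ for all } x\in(0,\infty),\qquad\text{or}\qquad \Phi(x)=-\frac{K}{2}x^{-2}\ \text{ for all } x\in(0,\infty).$$ In the first case $T=2\pi$ and in the second case $T=\pi$.
   Context: Let $V$ be a real-valued $C^2$ function (a potential) on an open interval $I\subset\mathbb{R}$. A point $x_*\in I$ is an equilibrium of $V$ if $V'(x_* )=0$. Given $T>0$, $V$ is called $T$-isochronous around the equilibrium $x_*$ if there is a neighborhood $\mathcal U\subset\mathbb{R}^2$ of $(x_*,0)$ such that every solution of the system $\dot x=y,\ \dot y=-V'(x)$ passing through $\mathcal U\setminus\{(x_*,0)\}$ is periodic with minimal period $T$. A family $\{V_\lambda\}_{\lambda>0}$ of $C^2$ potentials on $I$ is called $T$-isochronous if (1) for every $\lambda>0$, $V_\lambda$ has at most one equilibrium in $I$; (2) whenever $V_\lambda$ has an equilibrium, $V_\lambda$ is $T$-isochronous around it (with the same $T$ for all such $\lambda$); and (3) $V_\lambda$ has an equilibrium for at least one $\lambda>0$. Here $I=(0,\infty)$. *)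

theory Defs
  imports "HOL-Analysis.Analysis"
begin

text \<open>
  Potentials are total functions on the reals, but every definition below uses them only on the
  set \<open>I\<close>, which is meant to be an open interval.
\<close>

definition C2_on :: "real set \<Rightarrow> (real \<Rightarrow> real) \<Rightarrow> bool" where
  "C2_on I f \<longleftrightarrow> (\<forall>x\<in>I. f differentiable (at x)) \<and> deriv f C1_differentiable_on I"

definition equilibrium :: "real set \<Rightarrow> (real \<Rightarrow> real) \<Rightarrow> real \<Rightarrow> bool" where
  "equilibrium I V x \<longleftrightarrow> x \<in> I \<and> deriv V x = 0"

definition solution ::
  "real set \<Rightarrow> (real \<Rightarrow> real) \<Rightarrow> real set \<Rightarrow> (real \<Rightarrow> real) \<Rightarrow> (real \<Rightarrow> real) \<Rightarrow> bool" where
  "solution I V J x y \<longleftrightarrow> open J \<and> is_interval J \<and> J \<noteq> {} \<and>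
     (\<forall>t\<in>J. x t \<in> I \<and> (x has_real_derivative y t) (at t) \<and>
            (y has_real_derivative - deriv V (x t)) (at t))"

definition maximal_solution ::
  "real set \<Rightarrow> (real \<Rightarrow> real) \<Rightarrow> real set \<Rightarrow> (real \<Rightarrow> real) \<Rightarrow> (real \<Rightarrow> real) \<Rightarrow> bool" where
  "maximal_solution I V J x y \<longleftrightarrow> solution I V J x y \<and>
     (\<forall>J' x' y'. solution I V J' x' y' \<and> J \<subseteq> J' \<and> (\<forall>t\<in>J. x' t = x t \<and> y' t = y t) \<longrightarrow> J' = J)"

definition has_minimal_period :: "(real \<Rightarrow> 'a) \<Rightarrow> real \<Rightarrow> bool" where
  "has_minimal_period z T \<longleftrightarrow> T > 0 \<and> (\<forall>t. z (t + T) = z t) \<and>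
     (\<forall>S. 0 < S \<and> S < T \<longrightarrow> \<not> (\<forall>t. z (t + S) = z t))"

text \<open>
  ``Every solution through \<open>U\<close>'' means every maximal solution, so the solutions are required to
  exist for all times; restrictions of a periodic solution to a bounded time interval are not
  counted separately. Points of \<open>U\<close> whose first coordinate is outside \<open>I\<close> lie on no solution.
\<close>

definition isochronous_around :: "real set \<Rightarrow> real \<Rightarrow> (real \<Rightarrow> real) \<Rightarrow> real \<Rightarrow> bool" where
  "isochronous_around I T V x0 \<longleftrightarrow>
     (\<exists>U :: (real \<times> real) set. open U \<and> (x0, 0) \<in> U \<and>
        (\<forall>J x y. maximal_solution I V J x y \<and> (\<exists>t\<in>J. (x t, y t) \<in> U - {(x0, 0)}) \<longrightarrow>
           J = UNIV \<and> has_minimal_period (\<lambda>t. (x t, y t)) T))"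

definition isochronous_family :: "real set \<Rightarrow> real \<Rightarrow> (real \<Rightarrow> real \<Rightarrow> real) \<Rightarrow> bool" where
  "isochronous_family I T V \<longleftrightarrow>
     (\<forall>lam>0. C2_on I (V lam)) \<and>
     (\<forall>lam>0. \<forall>x y. equilibrium I (V lam) x \<and> equilibrium I (V lam) y \<longrightarrow> x = y) \<and>
     (\<forall>lam>0. \<forall>x. equilibrium I (V lam) x \<longrightarrow> isochronous_around I T (V lam) x) \<and>
     (\<exists>lam>0. \<exists>x. equilibrium I (V lam) x)"

end

theory Submission
  imports Defs "HOL-Real_Asymp.Real_Asymp"
begin

text \<open>
  A point \<open>x > 0\<close> with \<open>\<Phi>' x < 0\<close> is an equilibrium of exactly one member of the family, the one
  with parameter \<open>\<lambda> = - x / \<Phi>' x\<close>, and no other point is an equilibrium of any member.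
  So an isochronous family gives one local condition at every such point, and necessity comes from
  the first two of the coefficients in the expansion of the period at an equilibrium.

  First coefficient. Small oscillations have the linearised frequency, so
  \<open>V'' x = (2 * \<pi> / T)^2\<close>. Eliminating \<open>\<lambda>\<close> turns this into the Euler equation
  \<open>x * \<Phi>'' x = \<alpha> * \<Phi>' x\<close> with \<open>\<alpha> = 1 - (2 * \<pi> / T)^2\<close> on the set \<open>\<Phi>' < 0\<close>. Its
  solutions \<open>K * x powr \<alpha>\<close> do not reach zero at a positive point, so that set is the whole
  half-line (\<open>isochronous_family_power_law\<close>). This presupposes \<open>V'' x > 0\<close>.
  A saddle, \<open>V'' x < 0\<close>, has a branch of its separatrix on which the position is strictly monotone
  for all negative times, so it carries a non-periodic solution arbitrarily close to the
  equilibrium (\<open>no_isochronous_saddle\<close>). If \<open>V'' x = 0\<close>, then continuity gives \<open>V'' = 0\<close> at the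
  neighbouring equilibria too; this says that \<open>\<Phi>' z / z\<close> is locally constant, and then one member
  of the family has many equilibria.

  Second coefficient. For the power law the equilibrium can be placed at \<open>1\<close>. With the
  expansion \<open>V' = \<omega>^2 u + A u^2 + B u^3\<close> the next coefficient of the period vanishes exactly if
  \<open>10 A^2 = 9 \<omega>^2 B\<close>, and here this reads \<open>\<alpha> * (\<alpha> + 3) = 0\<close>
  (\<open>isochronous_power_exponent\<close>).

  Both coefficients are read off from one formula. Let \<open>g\<close> be the signed square root of
  \<open>2 (V - V x0)\<close> and \<open>G\<close> its inverse. On the orbit \<open>x = G (r sin \<theta>)\<close>, \<open>y = r cos \<theta>\<close> the
  equations of motion reduce to \<open>\<theta>' = g' (G (r sin \<theta>))\<close>, so the period is the integral over
  \<open>0 < \<theta> < \<pi>\<close> of \<open>H (r sin \<theta>)\<close>, where \<open>H s = s / V' (G s) - s / V' (G (- s))\<close>. By the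
  mean value theorem the value \<open>T / \<pi>\<close> is attained by \<open>H\<close> at arbitrarily small \<open>s > 0\<close>
  (\<open>period_of_centre\<close>). This alone determines the limit of \<open>H\<close> at \<open>0\<close> and forces its
  \<open>s^2\<close>-coefficient to vanish, so no period integral has to be expanded.

  Conversely, for the linear \<open>\<Phi>\<close> every member is a shifted harmonic oscillator. For the
  inverse-square \<open>\<Phi>\<close> the square of the position, with its mean subtracted, is a harmonic oscillator
  of frequency \<open>2\<close>.
\<close>

section \<open>Autonomous equations on the line\<close>

lemma inverse_of_increasing:
  fixes g q :: "real \<Rightarrow> real"
  assumes S: "open S" "is_interval S"
    and g': "\<And>x. x \<in> S \<Longrightarrow> (g has_real_derivative q x) (at x)"
    and q: "\<And>x. x \<in> S \<Longrightarrow> q x > 0"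
  obtains G where "\<And>x. x \<in> S \<Longrightarrow> G (g x) = x"
    "\<And>x. x \<in> S \<Longrightarrow> (G has_real_derivative 1 / q x) (at (g x))"
proof -
  have mono: "g a < g b" if "a \<in> S" "b \<in> S" "a < b" for a b
    using DERIV_pos_imp_increasing[OF \<open>a < b\<close>, of g] g' q S(2) that
    by (meson is_interval_1)
  then have inj: "inj_on g S"
    by (metis inj_onI linorder_neqE_linordered_idom order_less_irrefl)
  define G where "G = the_inv_into S g"
  have G: "G (g x) = x" if "x \<in> S" for x
    using inj that by (simp add: G_def the_inv_into_f_f)
  have "(G has_real_derivative 1 / q x) (at (g x))" if "x \<in> S" for x
    unfolding has_field_derivative_def
  proof (rule has_derivative_inverse_on[where S = S and f = g and f' = "\<lambda>x. (*) (q x)"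
        and g' = "\<lambda>x. (*) (1 / q x)"])
    show "open S" "x \<in> S" "\<And>x. x \<in> S \<Longrightarrow> G (g x) = x" using S that G by auto
    show "(g has_derivative (*) (q x)) (at x)" if "x \<in> S" for x
      using g'[OF that] by (simp add: has_field_derivative_def)
    show "(*) (q x) \<circ> (*) (1 / q x) = id"
      using q[OF that] by (auto simp: fun_eq_iff)
  qed
  with G that show ?thesis by blast
qed

text \<open>
  Separation of variables: the time \<open>\<tau>\<close> needed to reach a position is an antiderivative of
  \<open>1 / k\<close>, and the flow \<open>\<theta>\<close> is its inverse. The upper bound on \<open>k\<close> makes \<open>\<tau>\<close> unbounded in
  both directions, so that \<open>\<theta>\<close> is defined for all times.
\<close>

lemma autonomous_flow:
  fixes k :: "real \<Rightarrow> real"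
  assumes cont: "\<And>x. isCont k x" and m: "0 < m" "\<And>x. m \<le> k x" and M: "\<And>x. k x \<le> M"
  obtains \<theta> \<tau> where "\<And>t. (\<theta> has_real_derivative k (\<theta> t)) (at t)"
    "\<And>s. (\<tau> has_real_derivative 1 / k s) (at s)"
    "\<And>s. \<theta> (\<tau> s) = s" "\<And>t. \<tau> (\<theta> t) = t" "\<tau> s0 = 0"
proof -
  have kpos: "k x > 0" for x using m by (metis less_le_trans)
  have Mpos: "M > 0" using kpos[of 0] M[of 0] by linarith
  obtain F where F: "\<And>x. (F has_real_derivative 1 / k x) (at x)"
  proof -
    have "isCont (\<lambda>x. 1 / k x) x" for x
      using cont kpos[of x] by (intro continuous_intros) auto
    then obtain F where "\<forall>x::real. -\<infinity> < ereal x \<longrightarrow> ereal x < \<infinity> \<longrightarrow>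
        (F has_vector_derivative 1 / k x) (at x)"
      using einterval_antiderivative[of "-\<infinity>" "\<infinity>" "\<lambda>x. 1 / k x"] by auto
    then show ?thesis
      using that by (auto simp: has_real_derivative_iff_has_vector_derivative)
  qed
  define \<tau> where "\<tau> s = F s - F s0" for s
  have \<tau>': "(\<tau> has_real_derivative 1 / k s) (at s)" for s
    unfolding \<tau>_def by (auto intro!: derivative_eq_intros F)
  have \<tau>cont: "continuous_on X \<tau>" for X
    by (meson DERIV_isCont \<tau>' continuous_at_imp_continuous_on)
  have grow: "(b - a) / M \<le> \<tau> b - \<tau> a" if ab: "a \<le> b" for a b
  proof (cases "a = b")
    case False
    then obtain z where "\<tau> b - \<tau> a = (b - a) * (1 / k z)"
      using MVT2[of a b \<tau> "\<lambda>s. 1 / k s"] \<tau>' ab by auto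
    moreover have "1 / M \<le> 1 / k z" using M kpos by (simp add: frac_le)
    ultimately show ?thesis using ab
      by (metis diff_ge_0_iff_ge divide_inverse inverse_eq_divide mult_left_mono)
  qed auto
  have surj: "\<exists>s. \<tau> s = y" for y
  proof -
    have "\<tau> (s0 - M * \<bar>y\<bar>) \<le> y" "y \<le> \<tau> (s0 + M * \<bar>y\<bar>)"
      using grow[of "s0 - M * \<bar>y\<bar>" s0] grow[of s0 "s0 + M * \<bar>y\<bar>"] Mpos
      by (auto simp: \<tau>_def)
    then show ?thesis
      using IVT'[OF _ _ _ \<tau>cont, of "s0 - M * \<bar>y\<bar>" y "s0 + M * \<bar>y\<bar>"] Mpos by auto
  qed
  obtain \<theta> where \<theta>\<tau>: "\<And>s. \<theta> (\<tau> s) = s"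
    and \<theta>': "\<And>s. (\<theta> has_real_derivative 1 / (1 / k s)) (at (\<tau> s))"
    using inverse_of_increasing[of UNIV \<tau> "\<lambda>s. 1 / k s"] \<tau>' kpos by auto
  have \<tau>\<theta>: "\<tau> (\<theta> t) = t" for t
    using surj[of t] \<theta>\<tau> by metis
  have "(\<theta> has_real_derivative k (\<theta> t)) (at t)" for t
    using \<theta>'[of "\<theta> t"] by (simp add: \<tau>\<theta>)
  then show ?thesis using that[OF _ \<tau>' \<theta>\<tau> \<tau>\<theta>] by (simp add: \<tau>_def[of s0])
qed

section \<open>Extension to maximal solutions\<close>

text \<open>
  The definition of an isochronous equilibrium speaks about maximal solutions only, so a solution on
  a half-line must be extended before it can refute isochronicity. Zorn's lemma is applied to the
  graphs of the extensions, ordered by inclusion: two graphs in a chain agree at the common times,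
  so the union of the chain is again the graph of a solution.
\<close>

lemma solution_extends_to_maximal:
  assumes sol: "solution I V J x y"
  shows "\<exists>J' x' y'. maximal_solution I V J' x' y' \<and> J \<subseteq> J' \<and> (\<forall>t\<in>J. x' t = x t \<and> y' t = y t)"
proof -
  define graph where "graph J x y = (\<lambda>t. (t, x t, y t)) ` J"
    for J :: "real set" and x y :: "real \<Rightarrow> real"
  define E where "E = {graph J' x' y' | J' x' y'. solution I V J' x' y' \<and> graph J x y \<subseteq> graph J' x' y'}"
  have graph_mono: "graph J1 x1 y1 \<subseteq> graph J2 x2 y2 \<longleftrightarrow>
      J1 \<subseteq> J2 \<and> (\<forall>t\<in>J1. x2 t = x1 t \<and> y2 t = y1 t)" for J1 J2 x1 x2 y1 y2
    by (auto simp: graph_def image_subset_iff)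
  have fst_graph: "fst ` graph J1 x1 y1 = J1" for J1 x1 y1
    by (simp add: graph_def image_image)
  have "\<exists>M\<in>E. \<forall>X\<in>E. M \<subseteq> X \<longrightarrow> X = M"
  proof (rule subset_Zorn_nonempty)
    show "E \<noteq> {}" using sol by (auto simp: E_def)
  next
    fix C assume C0: "C \<noteq> {}" and chain: "subset.chain E C"
    define M where "M = \<Union> C"
    have functional: "p = q" if p: "p \<in> M" and q: "q \<in> M" and e: "fst p = fst q" for p q
    proof -
      obtain P Q where PQ: "p \<in> P" "q \<in> Q" "P \<in> C" "Q \<in> C" using p q by (auto simp: M_def)
      then have "P \<subseteq> Q \<or> Q \<subseteq> P" using chain by (meson subset.chain_def subset_chain_def)
      then obtain R where R: "p \<in> R" "q \<in> R" "R \<in> C" using PQ by auto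
      then have "R \<in> E" using chain by (auto simp: subset_chain_def)
      then show ?thesis using R e by (auto simp: E_def graph_def)
    qed
    define J' where "J' = fst ` M"
    define w where "w t = (THE v. (t, v) \<in> M)" for t
    have w: "w t = v" if "(t, v) \<in> M" for t v
      unfolding w_def using that functional by (metis (no_types, lifting) fst_conv prod.inject the_equality)
    define x' y' where "x' t = fst (w t)" and "y' t = snd (w t)" for t
    have Mg: "M = graph J' x' y'"
      unfolding graph_def J'_def x'_def y'_def using w by (force simp: image_iff)
    have piece: "\<exists>J1 x1 y1. c = graph J1 x1 y1 \<and> solution I V J1 x1 y1 \<and> J \<subseteq> J1 \<and> J1 \<subseteq> J' \<and>
        (\<forall>t\<in>J1. x' t = x1 t \<and> y' t = y1 t)" if "c \<in> C" for c
    proof -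
      have "c \<in> E" using chain that by (auto simp: subset_chain_def)
      then obtain J1 x1 y1 where c: "c = graph J1 x1 y1" "solution I V J1 x1 y1"
          "graph J x y \<subseteq> graph J1 x1 y1" by (auto simp: E_def)
      moreover have "c \<subseteq> graph J' x' y'" using that Mg M_def by blast
      ultimately show ?thesis using graph_mono by metis
    qed
    have J'eq: "J' = \<Union> ((`) fst ` C)" by (auto simp: J'_def M_def)
    have img: "open (fst ` c) \<and> connected (fst ` c) \<and> J \<subseteq> fst ` c" if cC: "c \<in> C" for c
    proof -
      obtain J1 x1 y1 where c: "c = graph J1 x1 y1" "solution I V J1 x1 y1" "J \<subseteq> J1"
        using piece[OF cC] by metis
      have "fst ` c = J1" unfolding c(1) by (rule fst_graph)
      then show ?thesis using c(2,3) by (simp add: solution_def is_interval_connected_1)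
    qed
    obtain t0 where t0: "t0 \<in> J" using sol by (auto simp: solution_def)
    have "open J'" unfolding J'eq using img by blast
    moreover have "is_interval J'" unfolding J'eq is_interval_connected_1
      using img t0 by (intro connected_Union) blast+
    moreover have "J' \<noteq> {}" unfolding J'eq using C0 img t0 by fastforce
    moreover have "x' t \<in> I \<and> (x' has_real_derivative y' t) (at t) \<and>
        (y' has_real_derivative - deriv V (x' t)) (at t)" if tJ: "t \<in> J'" for t
    proof -
      obtain c where c: "c \<in> C" "t \<in> fst ` c" using tJ J'eq by auto
      obtain J1 x1 y1 where P: "c = graph J1 x1 y1" "solution I V J1 x1 y1" "J1 \<subseteq> J'"
          "\<And>t. t \<in> J1 \<Longrightarrow> x' t = x1 t \<and> y' t = y1 t" using piece[OF c(1)] by metis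
      have t: "t \<in> J1" "open J1" using c(2) P(2) unfolding P(1) fst_graph by (auto simp: solution_def)
      have "(x1 has_real_derivative y1 t) (at t)" "(y1 has_real_derivative - deriv V (x1 t)) (at t)"
          "x1 t \<in> I"
        using P(2) t by (auto simp: solution_def)
      then show ?thesis
        using P(4) has_field_derivative_transform_within_open[OF _ t(2,1), of x1 _ x']
          has_field_derivative_transform_within_open[OF _ t(2,1), of y1 _ y'] t(1)
        by simp
    qed
    ultimately have "solution I V J' x' y'" by (simp add: solution_def)
    moreover have "graph J x y \<subseteq> M"
    proof -
      obtain c where "c \<in> C" using C0 by auto
      moreover from this have "c \<in> E" using chain by (auto simp: subset_chain_def)
      ultimately show ?thesis by (auto simp: E_def M_def)
    qed
    ultimately show "\<Union> C \<in> E" unfolding E_def using Mg M_def by blast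
  qed
  then obtain N where N: "N \<in> E" "\<forall>X\<in>E. N \<subseteq> X \<longrightarrow> X = N" by blast
  then obtain J' x' y' where N': "N = graph J' x' y'" "solution I V J' x' y'"
      "graph J x y \<subseteq> graph J' x' y'"
    by (auto simp: E_def)
  have "maximal_solution I V J' x' y'"
    unfolding maximal_solution_def
  proof (intro conjI allI impI)
    fix J2 x2 y2 assume a: "solution I V J2 x2 y2 \<and> J' \<subseteq> J2 \<and> (\<forall>t\<in>J'. x2 t = x' t \<and> y2 t = y' t)"
    then have "N \<subseteq> graph J2 x2 y2" using graph_mono N' by auto
    moreover from this have "graph J2 x2 y2 \<in> E" using a N' unfolding E_def by blast
    ultimately have "graph J2 x2 y2 = graph J' x' y'" using N N' by auto
    then show "J2 = J'" using graph_mono by blast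
  qed (use N' in auto)
  then show ?thesis using N' graph_mono by blast
qed

section \<open>The period near a nondegenerate centre\<close>

lemma second_order_quotient:
  fixes V f :: "real \<Rightarrow> real"
  assumes "open I" "x0 \<in> I" and V': "\<And>x. x \<in> I \<Longrightarrow> (V has_real_derivative f x) (at x)"
    and f0: "f x0 = 0" and f': "(f has_real_derivative v) (at x0)"
  shows "((\<lambda>x. (V x - V x0) / (x - x0)\<^sup>2) \<longlongrightarrow> v / 2) (at x0)"
proof (rule lhopital[where f' = f and g' = "\<lambda>x. 2 * (x - x0)"])
  have ev: "\<forall>\<^sub>F x in at x0. x \<in> I"
    using assms(1,2) eventually_at_in_open' by blast
  show "((\<lambda>x. V x - V x0) \<longlongrightarrow> 0) (at x0)"
    using DERIV_isCont[OF V'[OF assms(2)]] by (simp add: isCont_def LIM_zero)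
  show "((\<lambda>x. (x - x0)\<^sup>2) \<longlongrightarrow> 0) (at x0)" by (auto intro!: tendsto_eq_intros)
  show "\<forall>\<^sub>F x in at x0. (x - x0)\<^sup>2 \<noteq> 0" "\<forall>\<^sub>F x in at x0. 2 * (x - x0) \<noteq> 0"
    by (auto simp: eventually_at_filter)
  show "\<forall>\<^sub>F x in at x0. ((\<lambda>x. V x - V x0) has_real_derivative f x) (at x)"
    using ev by eventually_elim (auto intro!: derivative_eq_intros V')
  show "\<forall>\<^sub>F x in at x0. ((\<lambda>x. (x - x0)\<^sup>2) has_real_derivative 2 * (x - x0)) (at x)"
    by (auto intro!: always_eventually derivative_eq_intros)
  have "((\<lambda>x. (f x - f x0) / (x - x0) / 2) \<longlongrightarrow> v / 2) (at x0)"
    using f' by (intro tendsto_intros) (auto simp: has_field_derivative_iff)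
  then show "((\<lambda>x. f x / (2 * (x - x0))) \<longlongrightarrow> v / 2) (at x0)"
    by (simp add: f0 field_simps)
qed


text \<open>
  The neighbourhood in the phase plane may be taken to be a box, which separates the smallness
  conditions on the position and on the velocity.
\<close>

lemma isochronous_around_nbhd:
  assumes "isochronous_around I T V x0"
  shows "\<exists>d>0. \<forall>J x y t. maximal_solution I V J x y \<and> t \<in> J \<and> \<bar>x t - x0\<bar> < d \<and> \<bar>y t\<bar> < d \<and>
       (x t \<noteq> x0 \<or> y t \<noteq> 0) \<longrightarrow> J = UNIV \<and> has_minimal_period (\<lambda>t. (x t, y t)) T"
proof -
  obtain U where U: "open U" "(x0, 0) \<in> U" and
    iso: "\<forall>J x y. maximal_solution I V J x y \<and> (\<exists>t\<in>J. (x t, y t) \<in> U - {(x0, 0)}) \<longrightarrow>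
       J = UNIV \<and> has_minimal_period (\<lambda>t. (x t, y t)) T"
    using assms unfolding isochronous_around_def by blast
  obtain A B where AB: "open A" "open B" "(x0, 0) \<in> A \<times> B" "A \<times> B \<subseteq> U"
    by (rule open_prod_elim[OF U])
  obtain d1 d2 where d: "d1 > 0" "d2 > 0" "\<And>x. dist x x0 < d1 \<Longrightarrow> x \<in> A" "\<And>y. dist y 0 < d2 \<Longrightarrow> y \<in> B"
    using AB(1-3) unfolding open_dist mem_Times_iff fst_conv snd_conv by metis
  have "J = UNIV \<and> has_minimal_period (\<lambda>t. (x t, y t)) T"
    if "maximal_solution I V J x y" "t \<in> J" "\<bar>x t - x0\<bar> < min d1 d2" "\<bar>y t\<bar> < min d1 d2"
      "x t \<noteq> x0 \<or> y t \<noteq> 0" for J x y t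
  proof -
    have "x t \<in> A" "y t \<in> B" using d(3)[of "x t"] d(4)[of "y t"] that by (auto simp: dist_real_def)
    then have "(x t, y t) \<in> U - {(x0, 0)}" using AB that by auto
    then show ?thesis using iso that(1,2) by blast
  qed
  then show ?thesis using d(1,2)
    by (intro exI[of _ "min d1 d2"] conjI allI impI) (auto simp del: not_all)
qed

text \<open>
  The orbits around a nondegenerate minimum of \<open>V\<close> are written down in the angle variable of the
  introduction, which also proves that they exist for all times. Each orbit close to \<open>x0\<close> must have
  minimal period \<open>T\<close>, and this period is the increase of \<open>s \<mapsto> \<tau> s + \<tau> (s + \<pi>)\<close> over
  \<open>[0, \<pi>]\<close>. The mean value theorem for this function yields the points \<open>a\<close> and \<open>b\<close>, which lie on
  either side of \<open>x0\<close> at the same height \<open>s^2 / 2\<close> of the potential.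
\<close>

theorem period_of_centre:
  fixes V f :: "real \<Rightarrow> real"
  assumes iso: "isochronous_around I T V x0"
    and I: "open I" "x0 \<in> I"
    and V': "\<And>x. x \<in> I \<Longrightarrow> (V has_real_derivative f x) (at x)"
    and fcont: "continuous_on I f"
    and f0: "f x0 = 0" and f': "(f has_real_derivative v) (at x0)" and v: "v > 0"
    and \<epsilon>: "\<epsilon> > 0"
  shows "\<exists>a b s. x0 - \<epsilon> < b \<and> b < x0 \<and> x0 < a \<and> a < x0 + \<epsilon> \<and> s > 0 \<and>
    V a - V x0 = s\<^sup>2 / 2 \<and> V b - V x0 = s\<^sup>2 / 2 \<and> s / f a - s / f b = T / pi"
proof -
  obtain d1 where d1: "d1 > 0" and
    per: "\<forall>J x y t. maximal_solution I V J x y \<and> t \<in> J \<and> \<bar>x t - x0\<bar> < d1 \<and> \<bar>y t\<bar> < d1 \<and>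
       (x t \<noteq> x0 \<or> y t \<noteq> 0) \<longrightarrow> J = UNIV \<and> has_minimal_period (\<lambda>t. (x t, y t)) T"
    using isochronous_around_nbhd[OF iso] by blast
  define W where "W x = V x - V x0" for x
  have W': "(W has_real_derivative f x) (at x)" if "x \<in> I" for x
    unfolding W_def using V'[OF that] by (auto intro!: derivative_eq_intros)
  have lim1: "((\<lambda>x. f x / (x - x0)) \<longlongrightarrow> v) (at x0)"
    using f' by (simp add: has_field_derivative_iff f0)
  have lim2: "((\<lambda>x. W x / (x - x0)\<^sup>2) \<longlongrightarrow> v / 2) (at x0)"
    unfolding W_def by (rule second_order_quotient[OF I V' f0 f'])
  have "\<forall>\<^sub>F x in at x0. x \<in> I \<and> f x / (x - x0) > 0 \<and> W x / (x - x0)\<^sup>2 > 0"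
    using eventually_at_in_open'[OF I] order_tendstoD(1)[OF lim1 v] order_tendstoD(1)[OF lim2, of 0] v
    by (simp add: eventually_conj_iff)
  then obtain d0 where d0: "d0 > 0"
    "\<And>x. x \<noteq> x0 \<Longrightarrow> \<bar>x - x0\<bar> < d0 \<Longrightarrow> x \<in> I \<and> f x / (x - x0) > 0 \<and> W x / (x - x0)\<^sup>2 > 0"
    unfolding eventually_at by (auto simp: dist_real_def)
  define d where "d = min (min d0 d1) \<epsilon>"
  have d: "d > 0" "d \<le> d1" "d \<le> \<epsilon>" using d0 d1 \<epsilon> by (auto simp: d_def)
  define S where "S = {x0 - d<..<x0 + d}"
  have S: "open S" "is_interval S" "x0 \<in> S" using d by (auto simp: S_def)
  have SI: "x \<in> I" if "x \<in> S" for x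
    using d0(2)[of x] I that by (cases "x = x0") (auto simp: S_def d_def)
  have sgnf: "f x * (x - x0) > 0" and Wpos: "W x > 0" if "x \<in> S" "x \<noteq> x0" for x
    using d0(2)[of x] that by (auto simp: S_def d_def zero_less_divide_iff zero_less_mult_iff)
  define g where "g x = sgn (x - x0) * sqrt (2 * W x)" for x
  define Q where "Q x = (if x = x0 then sqrt v else f x / g x)" for x
  have W0: "W x0 = 0" and g0: "g x0 = 0" by (auto simp: W_def g_def)
  have gsq: "(g x)\<^sup>2 = 2 * W x" if "x \<in> S" for x
    using Wpos[OF that] W0 by (cases "x = x0") (auto simp: g_def power_mult_distrib sgn_if)
  have sgng: "g x * (x - x0) > 0" if "x \<in> S" "x \<noteq> x0" for x
    using Wpos[OF that] that by (auto simp: g_def sgn_if mult_less_0_iff)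
  have gQ: "g x * Q x = f x" if "x \<in> S" for x
    using sgng[OF that] by (cases "x = x0") (auto simp: Q_def g0 f0)
  have Qpos: "Q x > 0" if "x \<in> S" for x
    using sgng[OF that] sgnf[OF that] v
    by (cases "x = x0") (auto simp: Q_def zero_less_divide_iff zero_less_mult_iff)
  \<comment> \<open>The signed root removes the singularity of the square root at the minimum: \<open>g\<close> is
    differentiable at \<open>x0\<close> as well, with the linearised frequency as its derivative.\<close>
  have quot: "((\<lambda>x. g x / (x - x0)) \<longlongrightarrow> sqrt v) (at x0)"
  proof -
    have "((\<lambda>x. sqrt (2 * (W x / (x - x0)\<^sup>2))) \<longlongrightarrow> sqrt (2 * (v / 2))) (at x0)"
      by (rule tendsto_real_sqrt[OF tendsto_mult[OF tendsto_const lim2]])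
    moreover have "sqrt (2 * (W x / (x - x0)\<^sup>2)) = g x / (x - x0)" if "x \<noteq> x0" for x
    proof -
      have "sqrt (2 * (W x / (x - x0)\<^sup>2)) = sqrt (2 * W x) / \<bar>x - x0\<bar>"
        by (simp add: real_sqrt_divide)
      then show ?thesis using that minus_divide_right[of "sqrt (2 * W x)" "x - x0"]
        by (auto simp: g_def sgn_if abs_if)
    qed
    ultimately show ?thesis
      by (auto elim!: Lim_transform_eventually simp: eventually_at_filter)
  qed
  have g': "(g has_real_derivative Q x) (at x)" if x: "x \<in> S" for x
  proof (cases "x = x0")
    case True
    then show ?thesis using quot by (simp add: has_field_derivative_iff Q_def g0)
  next
    case False
    define X where "X = {z \<in> S. sgn (z - x0) = sgn (x - x0)}"
    have X: "X = (if x > x0 then S \<inter> {x0<..} else S \<inter> {..<x0})"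
      using False by (auto simp: X_def sgn_if split: if_splits)
    have "open X" "x \<in> X" unfolding X using S x False by auto
    have "((\<lambda>z. sgn (x - x0) * sqrt (2 * W z)) has_real_derivative Q x) (at x)"
      using Wpos[OF x False] False
      by (auto intro!: derivative_eq_intros W' SI x simp: Q_def g_def field_simps sgn_if)
    then show ?thesis
      by (rule has_field_derivative_transform_within_open[OF _ \<open>open X\<close> \<open>x \<in> X\<close>])
        (auto simp: X_def g_def)
  qed
  have gcont: "continuous_on X g" if "X \<subseteq> S" for X
    using g' that by (meson DERIV_isCont continuous_at_imp_continuous_on subsetD)
  have Qcont: "isCont Q x" if x: "x \<in> S" for x
  proof (cases "x = x0")
    case True
    have "((\<lambda>x. (f x / (x - x0)) / (g x / (x - x0))) \<longlongrightarrow> v / sqrt v) (at x0)"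
      using tendsto_divide[OF lim1 quot] v by simp
    moreover have "v / sqrt v = sqrt v" using v by (simp add: real_div_sqrt)
    ultimately have "(Q \<longlongrightarrow> sqrt v) (at x0)"
      by (auto elim!: Lim_transform_eventually simp: eventually_at_filter Q_def)
    then show ?thesis using True by (simp add: isCont_def Q_def)
  next
    case False
    have "isCont f x" using fcont I SI[OF x] by (simp add: continuous_on_eq_continuous_at)
    moreover have "isCont g x" using g'[OF x] DERIV_isCont by blast
    moreover have "g x \<noteq> 0" using sgng[OF x False] by auto
    ultimately have "isCont (\<lambda>x. f x / g x) x" by (intro continuous_intros)
    moreover have "\<forall>\<^sub>F z in nhds x. f z / g z = Q z"
      using t1_space_nhds[OF False] by eventually_elim (simp add: Q_def)
    ultimately show ?thesis using isCont_cong[of "\<lambda>x. f x / g x" Q x] by simp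
  qed
  obtain G where G: "\<And>x. x \<in> S \<Longrightarrow> G (g x) = x"
    and G': "\<And>x. x \<in> S \<Longrightarrow> (G has_real_derivative 1 / Q x) (at (g x))"
    using inverse_of_increasing[OF S(1,2) g' Qpos] by blast
  define c e where "c = x0 - d / 2" and "e = x0 + d / 2"
  have ce: "c < x0" "x0 < e" "{c..e} \<subseteq> S" using d by (auto simp: c_def e_def S_def)
  have ceS: "c \<in> S" "e \<in> S" using d by (auto simp: c_def e_def S_def)
  \<comment> \<open>A radius for which \<open>\<theta>\<close> may run through all angles: \<open>G\<close> is needed on \<open>[-r, r]\<close> only.\<close>
  define r where "r = min (min (g e) (- g c)) (d / 2)"
  have r: "r > 0" "r \<le> g e" "g c \<le> - r" "r < d"
    using sgng[of c] sgng[of e] ce d ceS by (auto simp: r_def zero_less_mult_iff)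
  have Gr: "G s \<in> {c..e} \<and> g (G s) = s" if sr: "\<bar>s\<bar> \<le> r" for s
  proof -
    obtain x where "c \<le> x" "x \<le> e" "g x = s"
      using IVT'[of g c s e] gcont[OF ce(3)] r sr ce by (auto simp: abs_le_iff)
    moreover from this have "G s = x" using G[of x] ce by auto
    ultimately show ?thesis by auto
  qed
  have Gd: "(G has_real_derivative 1 / Q (G s)) (at s)" if "\<bar>s\<bar> \<le> r" for s
    using G'[of "G s"] Gr[OF that] ce by auto
  have rs: "\<bar>r * sin \<theta>\<bar> \<le> r" for \<theta>
    using r abs_sin_le_one[of \<theta>] by (simp add: abs_mult mult_left_le)
  \<comment> \<open>The angular velocity on the orbit of radius \<open>r\<close> in the \<open>(g, y)\<close>-plane.\<close>
  define k where "k \<theta> = Q (G (r * sin \<theta>))" for \<theta>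
  have kcont: "isCont k \<theta>" for \<theta>
  proof -
    have "isCont G (r * sin \<theta>)" using Gd[OF rs] DERIV_isCont by blast
    then have "isCont (\<lambda>\<theta>. G (r * sin \<theta>)) \<theta>"
      by (rule isCont_o2[where f = "\<lambda>\<theta>. r * sin \<theta>" and g = G, rotated]) (intro continuous_intros)
    moreover have "isCont Q (G (r * sin \<theta>))" using Qcont Gr[OF rs] ce by blast
    ultimately show ?thesis unfolding k_def by (rule isCont_o2)
  qed
  have "continuous_on {c..e} Q" using Qcont ce by (meson continuous_at_imp_continuous_on subsetD)
  then obtain z1 z2 where z: "z1 \<in> {c..e}" "\<And>z. z \<in> {c..e} \<Longrightarrow> Q z1 \<le> Q z"
      "z2 \<in> {c..e}" "\<And>z. z \<in> {c..e} \<Longrightarrow> Q z \<le> Q z2"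
    using continuous_attains_inf[of "{c..e}" Q] continuous_attains_sup[of "{c..e}" Q] ce
    by (metis atLeastAtMost_iff compact_Icc empty_iff less_eq_real_def)
  have kbd: "Q z1 \<le> k \<theta>" "k \<theta> \<le> Q z2" for \<theta>
    using z Gr[OF rs] by (auto simp: k_def)
  have Qz1: "Q z1 > 0" using Qpos z ce by blast
  obtain \<theta> \<tau> where \<theta>': "\<And>t. (\<theta> has_real_derivative k (\<theta> t)) (at t)"
    and \<tau>': "\<And>s. (\<tau> has_real_derivative 1 / k s) (at s)"
    and \<theta>\<tau>: "\<And>s. \<theta> (\<tau> s) = s" and \<tau>\<theta>: "\<And>t. \<tau> (\<theta> t) = t" and \<tau>0: "\<tau> 0 = 0"
    using autonomous_flow[OF kcont Qz1 kbd] by blast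
  have kpos: "k s > 0" for s using kbd(1)[of s] Qz1 by linarith
  have \<tau>mono: "\<tau> a < \<tau> b" if "a < b" for a b
    using DERIV_pos_imp_increasing[OF that, of \<tau>] \<tau>' kpos by (metis divide_pos_pos zero_less_one)
  define P where "P = \<tau> (2 * pi)"
  have \<tau>per: "\<tau> (s + 2 * pi) = \<tau> s + P" for s
  proof -
    have "((\<lambda>s. \<tau> (s + 2 * pi) - \<tau> s) has_real_derivative 0) (at s)" for s
    proof -
      have "((\<lambda>s. \<tau> (s + 2 * pi)) has_real_derivative 1 / k s) (at s)"
      proof -
        have "((\<lambda>s. s + 2 * pi) has_real_derivative 1) (at s)"
          by (auto intro!: derivative_eq_intros)
        from DERIV_chain2[OF \<tau>' this] show ?thesis by (simp add: k_def)
      qed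
      then show ?thesis by (auto intro!: derivative_eq_intros \<tau>')
    qed
    then show ?thesis
      using DERIV_isconst_all[of "\<lambda>s. \<tau> (s + 2 * pi) - \<tau> s" s 0] \<tau>0 by (simp add: P_def)
  qed
  have \<theta>per: "\<theta> (t + P) = \<theta> t + 2 * pi" for t
    by (metis \<tau>per \<theta>\<tau> \<tau>\<theta>)
  define X Y where "X t = G (r * sin (\<theta> t))" and "Y t = r * cos (\<theta> t)" for t
  have XS: "X t \<in> {c..e}" "g (X t) = r * sin (\<theta> t)" for t using Gr[OF rs] by (auto simp: X_def)
  have XS': "X t \<in> S" for t using XS ce by blast
  have kX: "k (\<theta> t) = Q (X t)" for t by (simp add: k_def X_def)
  have sol: "solution I V UNIV X Y"
    unfolding solution_def
  proof (intro conjI ballI)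
    fix t
    show "X t \<in> I" using XS' SI by blast
    show "(X has_real_derivative Y t) (at t)"
    proof -
      have "((\<lambda>t. r * sin (\<theta> t)) has_real_derivative r * (cos (\<theta> t) * k (\<theta> t))) (at t)"
        by (auto intro!: derivative_eq_intros \<theta>')
      from DERIV_chain2[OF Gd[OF rs] this]
      have "(X has_real_derivative 1 / Q (X t) * (r * (cos (\<theta> t) * Q (X t)))) (at t)"
        by (simp only: k_def X_def[abs_def])
      moreover have "1 / Q (X t) * (r * (cos (\<theta> t) * Q (X t))) = Y t"
        using Qpos[OF XS'[of t]] by (simp add: Y_def)
      ultimately show ?thesis by simp
    qed
    have "((\<lambda>t. r * cos (\<theta> t)) has_real_derivative - (r * sin (\<theta> t) * k (\<theta> t))) (at t)"
      by (auto intro!: derivative_eq_intros \<theta>')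
    moreover have "r * sin (\<theta> t) * k (\<theta> t) = f (X t)"
      using gQ[OF XS'[of t]] XS(2)[of t] by (simp add: kX)
    moreover have "deriv V (X t) = f (X t)" using V'[OF SI[OF XS'[of t]]] DERIV_imp_deriv by blast
    ultimately show "(Y has_real_derivative - deriv V (X t)) (at t)"
      by (simp add: Y_def[abs_def])
  qed auto
  then have max: "maximal_solution I V UNIV X Y" by (auto simp: maximal_solution_def)
  have nz: "X 0 \<noteq> x0 \<or> Y 0 \<noteq> 0"
  proof (rule ccontr)
    assume "\<not> ?thesis"
    then have "sin (\<theta> 0) = 0" "cos (\<theta> 0) = 0" using XS(2)[of 0] g0 r by (auto simp: Y_def)
    then show False using sin_cos_squared_add[of "\<theta> 0"] by simp
  qed
  have "\<bar>r * cos (\<theta> 0)\<bar> \<le> r" using r abs_cos_le_one[of "\<theta> 0"] by (simp add: abs_mult mult_left_le)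
  then have "\<bar>Y 0\<bar> < d1" using r d by (auto simp: Y_def)
  moreover have "\<bar>X 0 - x0\<bar> < d1" using XS(1)[of 0] d by (auto simp: c_def e_def abs_if)
  ultimately have T: "has_minimal_period (\<lambda>t. (X t, Y t)) T"
    using per max nz by blast
  then have T0: "T > 0" and "\<forall>t. (X (t + T), Y (t + T)) = (X t, Y t)"
    by (auto simp: has_minimal_period_def)
  from this(2)[rule_format, of 0] have TY: "Y T = Y 0" by simp
  have "P > 0" using \<tau>mono[of 0 "2 * pi"] \<tau>0 by (simp add: P_def)
  have "\<forall>t. (X (t + P), Y (t + P)) = (X t, Y t)" by (simp add: X_def Y_def \<theta>per)
  then have "T \<le> P" using T \<open>P > 0\<close> unfolding has_minimal_period_def by (meson not_le)
  \<comment> \<open>Over a period the angle advances by a full number of turns, and by at least one.\<close>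
  moreover have "P \<le> T"
  proof -
    have \<theta>0: "\<theta> 0 = 0" using \<theta>\<tau>[of 0] \<tau>0 by simp
    have "cos (\<theta> T) = 1" using TY r \<theta>0 by (simp add: Y_def)
    then obtain n :: int where n: "\<theta> T = n * 2 * pi" using cos_one_2pi_int by auto
    have "\<theta> 0 < \<theta> T"
      using DERIV_pos_imp_increasing[OF T0, of \<theta>] \<theta>' kpos by metis
    then have "n \<ge> 1" using \<theta>0 n by (simp add: zero_less_mult_iff)
    then have "1 * (2 * pi) \<le> n * (2 * pi)" by (intro mult_right_mono) auto
    then have "2 * pi \<le> \<theta> T" using n by simp
    then have "P \<le> \<tau> (\<theta> T)" unfolding P_def using \<tau>mono by (metis less_eq_real_def)
    then show ?thesis by (simp add: \<tau>\<theta>)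
  qed
  ultimately have TP: "T = P" by simp
  \<comment> \<open>Opposite angles are paired so that the linear term of \<open>1 / g'\<close> along the orbit cancels.\<close>
  have "((\<lambda>s. \<tau> s + \<tau> (s + pi)) has_real_derivative 1 / k s + 1 / k (s + pi)) (at s)" for s
  proof -
    have "((\<lambda>s. s + pi) has_real_derivative 1) (at s)"
      by (auto intro!: derivative_eq_intros)
    from DERIV_add[OF \<tau>' DERIV_chain2[OF \<tau>' this]] show ?thesis by simp
  qed
  then obtain z where z: "0 < z" "z < pi"
      "(\<tau> pi + \<tau> (pi + pi)) - (\<tau> 0 + \<tau> (0 + pi)) = (pi - 0) * (1 / k z + 1 / k (z + pi))"
    using MVT2[of 0 pi "\<lambda>s. \<tau> s + \<tau> (s + pi)" "\<lambda>s. 1 / k s + 1 / k (s + pi)"] by auto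
  define s where "s = r * sin z"
  have s: "s > 0" "\<bar>s\<bar> \<le> r" "\<bar>-s\<bar> \<le> r" using r z sin_gt_zero rs[of z] by (auto simp: s_def)
  define a b where "a = G s" and "b = G (- s)"
  have ga: "g a = s" "g b = - s" and aS: "a \<in> {c..e}" "b \<in> {c..e}"
    using Gr s by (auto simp: a_def b_def)
  have ab: "a \<in> S" "b \<in> S" using aS ce by auto
  have ne: "a \<noteq> x0" "b \<noteq> x0" using ga g0 s by auto
  have pos: "x0 < a" "b < x0"
    using sgng[OF ab(1) ne(1)] sgng[OF ab(2) ne(2)] ga s by (auto simp: zero_less_mult_iff mult_less_0_iff)
  have "1 / k z = s / f a" "1 / k (z + pi) = - s / f b"
    using ga ne by (auto simp: k_def s_def[symmetric] a_def[symmetric] b_def[symmetric] Q_def)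
  then have "s / f a - s / f b = T / pi"
    using z(3) \<tau>0 by (simp add: TP P_def)
  moreover have "V a - V x0 = s\<^sup>2 / 2" "V b - V x0 = s\<^sup>2 / 2"
    using gsq[OF ab(1)] gsq[OF ab(2)] ga by (auto simp: W_def)
  moreover have "x0 - \<epsilon> < b" "a < x0 + \<epsilon>" using ab d by (auto simp: S_def)
  ultimately show ?thesis using pos s by blast
qed


text \<open>
  As the points \<open>a\<close> and \<open>b\<close> approach \<open>x0\<close>, both \<open>s / V' a\<close> and \<open>- s / V' b\<close> tend to
  \<open>1 / sqrt v\<close>.
\<close>

corollary centre_frequency:
  fixes V f :: "real \<Rightarrow> real"
  assumes iso: "isochronous_around I T V x0"
    and I: "open I" "x0 \<in> I"
    and V': "\<And>x. x \<in> I \<Longrightarrow> (V has_real_derivative f x) (at x)"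
    and fcont: "continuous_on I f"
    and f0: "f x0 = 0" and f': "(f has_real_derivative v) (at x0)" and v: "v > 0"
  shows "T = 2 * pi / sqrt v"
proof -
  have lim1: "((\<lambda>x. f x / (x - x0)) \<longlongrightarrow> v) (at x0)"
    using f' by (simp add: has_field_derivative_iff f0)
  have lim2: "((\<lambda>x. (V x - V x0) / (x - x0)\<^sup>2) \<longlongrightarrow> v / 2) (at x0)"
    by (rule second_order_quotient[OF I V' f0 f'])
  have "((\<lambda>x. sqrt (2 * ((V x - V x0) / (x - x0)\<^sup>2)) / (f x / (x - x0))) \<longlongrightarrow> sqrt (2 * (v / 2)) / v) (at x0)"
    using v by (intro tendsto_divide[OF tendsto_real_sqrt[OF tendsto_mult[OF tendsto_const lim2]] lim1]) simp
  then have lim: "((\<lambda>x. sqrt (2 * ((V x - V x0) / (x - x0)\<^sup>2)) / (f x / (x - x0))) \<longlongrightarrow> 1 / sqrt v) (at x0)"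
    using v by (simp add: sqrt_divide_self_eq inverse_eq_divide)
  have "\<bar>T / pi - 2 / sqrt v\<bar> < e" if "e > 0" for e
  proof -
    have "\<forall>\<^sub>F x in at x0. dist (sqrt (2 * ((V x - V x0) / (x - x0)\<^sup>2)) / (f x / (x - x0))) (1 / sqrt v) < e / 2"
      using tendstoD[OF lim, of "e / 2"] that by simp
    then obtain d where d: "d > 0" "\<And>x. x \<noteq> x0 \<Longrightarrow> \<bar>x - x0\<bar> < d \<Longrightarrow>
        \<bar>sqrt (2 * ((V x - V x0) / (x - x0)\<^sup>2)) / (f x / (x - x0)) - 1 / sqrt v\<bar> < e / 2"
      unfolding eventually_at by (auto simp: dist_real_def)
    obtain a b s where abs: "x0 - d < b" "b < x0" "x0 < a" "a < x0 + d" "s > 0"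
        "V a - V x0 = s\<^sup>2 / 2" "V b - V x0 = s\<^sup>2 / 2" "s / f a - s / f b = T / pi"
      using period_of_centre[OF iso I V' fcont f0 f' v d(1)] by blast
    have quot: "sqrt (2 * ((V x - V x0) / (x - x0)\<^sup>2)) = \<bar>s / (x - x0)\<bar>"
      if "V x - V x0 = s\<^sup>2 / 2" for x
    proof -
      have "2 * ((V x - V x0) / (x - x0)\<^sup>2) = (s / (x - x0))\<^sup>2"
        unfolding that by (simp add: power_divide)
      then show ?thesis by (simp only: real_sqrt_abs)
    qed
    have neg: "s / (b - x0) < 0" using abs(2,5) by (simp add: divide_pos_neg)
    have "\<bar>s / (a - x0)\<bar> / (f a / (a - x0)) = s / f a"
      using abs(3,5) by simp
    moreover have "\<bar>s / (b - x0)\<bar> / (f b / (b - x0)) = - (s / f b)"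
      unfolding abs_of_neg[OF neg] using abs(2) by simp
    ultimately have "\<bar>s / f a - 1 / sqrt v\<bar> < e / 2" "\<bar>- (s / f b) - 1 / sqrt v\<bar> < e / 2"
      using d(2)[of a] d(2)[of b] abs(1-4) quot[OF abs(6)] quot[OF abs(7)] by auto
    moreover have "T / pi - 2 / sqrt v = (s / f a - 1 / sqrt v) + (- (s / f b) - 1 / sqrt v)"
      using abs(8) by simp
    ultimately show ?thesis
      using abs_triangle_ineq[of "s / f a - 1 / sqrt v" "- (s / f b) - 1 / sqrt v"] by linarith
  qed
  then have "T / pi - 2 / sqrt v = 0"
    by (metis less_irrefl zero_less_abs_iff)
  then show ?thesis by (simp add: field_simps)
qed

section \<open>Saddles are not isochronous\<close>

text \<open>
  On the energy level of a saddle, to the right of \<open>x0\<close>, the velocity is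
  \<open>h x = sqrt (2 (V x0 - V x))\<close>, which is comparable to \<open>x - x0\<close>. The substitution
  \<open>x = x0 + exp s\<close> turns \<open>x' = h x\<close> into an equation for \<open>s\<close> whose right-hand side lies between
  positive constants, so this solution exists for all negative times. Its position is strictly
  increasing there, which no periodic extension permits.
\<close>

theorem no_isochronous_saddle:
  fixes V f :: "real \<Rightarrow> real"
  assumes iso: "isochronous_around I T V x0"
    and I: "open I" "x0 \<in> I"
    and V': "\<And>x. x \<in> I \<Longrightarrow> (V has_real_derivative f x) (at x)"
    and f0: "f x0 = 0" and f': "(f has_real_derivative v) (at x0)"
  shows "v \<ge> 0"
proof (rule ccontr)
  assume "\<not> v \<ge> 0"
  then have v: "v < 0" by simp
  obtain d1 where d1: "d1 > 0" and
    per: "\<forall>J x y t. maximal_solution I V J x y \<and> t \<in> J \<and> \<bar>x t - x0\<bar> < d1 \<and> \<bar>y t\<bar> < d1 \<and>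
       (x t \<noteq> x0 \<or> y t \<noteq> 0) \<longrightarrow> J = UNIV \<and> has_minimal_period (\<lambda>t. (x t, y t)) T"
    using isochronous_around_nbhd[OF iso] by blast
  define W where "W x = V x - V x0" for x
  have W': "(W has_real_derivative f x) (at x)" if "x \<in> I" for x
    unfolding W_def using V'[OF that] by (auto intro!: derivative_eq_intros)
  have lim: "((\<lambda>x. W x / (x - x0)\<^sup>2) \<longlongrightarrow> v / 2) (at x0)"
    unfolding W_def by (rule second_order_quotient[OF I V' f0 f'])
  have "\<forall>\<^sub>F x in at x0. x \<in> I \<and> v < W x / (x - x0)\<^sup>2 \<and> W x / (x - x0)\<^sup>2 < v / 4"
    using eventually_at_in_open'[OF I] order_tendstoD(1)[OF lim, of v] order_tendstoD(2)[OF lim, of "v / 4"] v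
    by (simp add: eventually_conj_iff)
  then obtain d0 where d0: "d0 > 0" "\<And>x. x \<noteq> x0 \<Longrightarrow> \<bar>x - x0\<bar> < d0 \<Longrightarrow>
      x \<in> I \<and> v < W x / (x - x0)\<^sup>2 \<and> W x / (x - x0)\<^sup>2 < v / 4"
    unfolding eventually_at by (auto simp: dist_real_def)
  \<comment> \<open>The bounds on the quotient come from its limit \<open>v / 2\<close>, where \<open>v < 0\<close>; they turn into the linear
    bounds \<open>m\<close> and \<open>M\<close> for \<open>h\<close>.\<close>
  define m M where "m = sqrt (- v / 2)" and "M = sqrt (- 2 * v)"
  have mM: "m > 0" "M > 0" using v by (auto simp: m_def M_def)
  define e where "e = min (min d0 d1) (d1 / M)"
  have e: "e > 0" "e \<le> d0" "e \<le> d1" "e \<le> d1 / M" using d0 d1 mM by (auto simp: e_def)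
  define d where "d = e / 2"
  have d: "d > 0" "d < d0" "d < d1" "d < d1 / M" using e proof -
    have "d > 0" "d < e" using e by (auto simp: d_def)
    then show "d > 0" "d < d0" "d < d1" "d < d1 / M" using e by auto
  qed
  define h where "h x = sqrt (- 2 * W x)" for x
  have near: "x \<in> I \<and> W x < 0 \<and> m * (x - x0) \<le> h x \<and> h x \<le> M * (x - x0)"
    if "x0 < x" "x \<le> x0 + d" for x
  proof -
    have b: "x \<in> I" "v < W x / (x - x0)\<^sup>2" "W x / (x - x0)\<^sup>2 < v / 4"
      using d0(2)[of x] that d by auto
    have p: "(x - x0)\<^sup>2 > 0" using that by simp
    have lo: "v * (x - x0)\<^sup>2 < W x" and hi: "W x < v / 4 * (x - x0)\<^sup>2"
      using b p by (auto simp: pos_less_divide_eq pos_divide_less_eq)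
    have "v / 4 * (x - x0)\<^sup>2 < 0" using v p by (simp add: mult_neg_pos)
    then have "W x < 0" using hi by simp
    moreover have "m * (x - x0) = sqrt (- v / 2 * (x - x0)\<^sup>2)" "M * (x - x0) = sqrt (- 2 * v * (x - x0)\<^sup>2)"
      unfolding m_def M_def real_sqrt_mult real_sqrt_abs using that by simp_all
    ultimately show ?thesis using lo hi b by (auto simp: h_def)
  qed
  \<comment> \<open>The cut-off at \<open>ln d\<close> only serves to define the equation for \<open>s\<close> on the whole line; the
    solution stays below it for negative times.\<close>
  define \<tau>1 where "\<tau>1 = ln d"
  define k where "k s = h (x0 + exp (min s \<tau>1)) / exp (min s \<tau>1)" for s
  have e': "x0 < x0 + exp (min s \<tau>1)" "x0 + exp (min s \<tau>1) \<le> x0 + d" for s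
  proof -
    have "exp (min s \<tau>1) \<le> exp \<tau>1" by simp
    then show "x0 + exp (min s \<tau>1) \<le> x0 + d" using d by (simp add: \<tau>1_def)
  qed simp
  have hcont: "isCont h x" if "x0 < x" "x \<le> x0 + d" for x
    using DERIV_isCont[OF W'] near[OF that] unfolding h_def by (intro continuous_intros) auto
  have kcont: "isCont k s" for s
  proof -
    have "isCont (\<lambda>s. x0 + exp (min s \<tau>1)) s" by (intro continuous_intros)
    from isCont_o2[OF this hcont[OF e']] show ?thesis
      unfolding k_def by (intro continuous_intros) auto
  qed
  have kbd: "m \<le> k s" "k s \<le> M" for s
    using near[OF e'[of s]] by (auto simp: k_def pos_le_divide_eq pos_divide_le_eq)
  obtain \<theta> \<tau> where \<theta>': "\<And>t. (\<theta> has_real_derivative k (\<theta> t)) (at t)"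
    and \<theta>\<tau>: "\<And>s. \<theta> (\<tau> s) = s" and \<tau>0: "\<tau> \<tau>1 = 0"
    using autonomous_flow[OF kcont mM(1) kbd, of \<tau>1] by metis
  have kpos: "k s > 0" for s using kbd(1)[of s] mM by linarith
  have \<theta>mono: "\<theta> a < \<theta> b" if "a < b" for a b
    using DERIV_pos_imp_increasing[OF that, of \<theta>] \<theta>' kpos by metis
  have \<theta>0: "\<theta> 0 = \<tau>1" using \<theta>\<tau>[of \<tau>1] \<tau>0 by simp
  define X where "X t = x0 + exp (\<theta> t)" for t
  have X: "x0 < X t" "X t \<le> x0 + d" "h (X t) = exp (\<theta> t) * k (\<theta> t)" if "t < 0" for t
  proof -
    have min: "min (\<theta> t) \<tau>1 = \<theta> t" using \<theta>mono[OF that] \<theta>0 by simp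
    show "x0 < X t" "X t \<le> x0 + d" "h (X t) = exp (\<theta> t) * k (\<theta> t)"
      using e'[of "\<theta> t"] unfolding k_def min X_def by auto
  qed
  have sol: "solution I V {..<0} X (\<lambda>t. h (X t))"
    unfolding solution_def
  proof (intro conjI ballI)
    fix t :: real assume "t \<in> {..<0}"
    then have t: "t < 0" by simp
    note n = near[OF X(1,2)[OF t]]
    show "X t \<in> I" using n by simp
    show X': "(X has_real_derivative h (X t)) (at t)"
      unfolding X(3)[OF t] unfolding X_def by (auto intro!: derivative_eq_intros \<theta>')
    have "deriv V (X t) = f (X t)" using V' n DERIV_imp_deriv by blast
    have "((\<lambda>x. sqrt (- 2 * W x)) has_real_derivative - f (X t) / h (X t)) (at (X t))"
      using n unfolding h_def
      by (auto intro!: derivative_eq_intros W' simp: field_simps)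
    from DERIV_chain2[OF this X']
    have "((\<lambda>t. h (X t)) has_real_derivative - f (X t) / h (X t) * h (X t)) (at t)"
      by (simp add: h_def)
    moreover have "h (X t) > 0" using n by (simp add: h_def)
    ultimately show "((\<lambda>t. h (X t)) has_real_derivative - deriv V (X t)) (at t)"
      using \<open>deriv V (X t) = f (X t)\<close> by simp
  qed (auto simp: is_interval_ci)
  obtain J' x' y' where ext: "maximal_solution I V J' x' y'" "{..<0} \<subseteq> J'"
      "\<forall>t\<in>{..<0}. x' t = X t \<and> y' t = h (X t)"
    using solution_extends_to_maximal[OF sol] by blast
  \<comment> \<open>The whole solution has been kept within \<open>d\<close> of \<open>x0\<close>, so one arbitrary negative time shows
    that it meets the neighbourhood.\<close>
  have n: "x0 < X (-1)" "X (-1) \<le> x0 + d" "0 < h (X (-1))" "h (X (-1)) \<le> M * d"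
    using X(1,2)[of "-1"] near[of "X (-1)"] mM
    by (auto simp: h_def intro: order_trans[OF _ mult_left_mono[of "X (-1) - x0" d M]])
  have "M * d < d1" using d(4) mM by (simp add: pos_less_divide_eq mult.commute)
  then have "\<bar>x' (-1) - x0\<bar> < d1" "\<bar>y' (-1)\<bar> < d1" "x' (-1) \<noteq> x0"
    using n ext(3)[rule_format, of "-1"] d by auto
  moreover have "-1 \<in> J'" using ext(2) by auto
  ultimately have "has_minimal_period (\<lambda>t. (x' t, y' t)) T"
    using per ext(1) by blast
  then have T: "T > 0" "\<forall>t. (x' (t + T), y' (t + T)) = (x' t, y' t)"
    by (auto simp: has_minimal_period_def)
  from T(2)[rule_format, of "- 1 - T"] have "x' (-1) = x' (-1 - T)" by simp
  then have "X (-1) = X (-1 - T)" using ext(3)[rule_format, of "-1"] ext(3)[rule_format, of "-1 - T"] T(1) by auto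
  then show False using \<theta>mono[of "-1 - T" "-1"] T(1) by (simp add: X_def)
qed

section \<open>The second-order condition\<close>

text \<open>
  Put \<open>R = 2 W / (\<omega> u)^2\<close> and \<open>S = f / (\<omega>^2 u)\<close>, both tending to \<open>1\<close>. Then
  \<open>g = u * sqrt R\<close> is the root of \<open>2 W\<close> with the sign of \<open>u\<close>, divided by \<open>\<omega>\<close>, and
  \<open>sqrt R / S\<close> equals \<open>\<omega>^2 * g / f\<close>. So \<open>g\<close> takes opposite values at the two points \<open>a\<close> and \<open>b\<close> of equal height. Removing the
  terms \<open>1\<close> and \<open>- p * g\<close> of the expansion of \<open>sqrt R / S\<close> leaves \<open>E u * u^2\<close>, so the hypothesis on
  \<open>a\<close> and \<open>b\<close> becomes \<open>E a * a^2 + E b * b^2 = 0\<close>. Hence the limit of \<open>E\<close> at \<open>0\<close> cannot be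
  nonzero, and this limit is a multiple of \<open>10 A^2 - 9 \<omega>^2 B\<close>.
\<close>

lemma isochronous_second_order:
  fixes W f :: "real \<Rightarrow> real" and \<omega> A B :: real
  assumes \<omega>: "\<omega> > 0"
    and W': "\<forall>\<^sub>F u in at 0. (W has_real_derivative f u) (at u)"
    and W0: "(W \<longlongrightarrow> 0) (at 0)"
    and f: "((\<lambda>u. (f u - \<omega>\<^sup>2 * u - A * u\<^sup>2) / u ^ 3) \<longlongrightarrow> B) (at 0)"
    and pairs: "\<And>\<epsilon>. \<epsilon> > 0 \<Longrightarrow> \<exists>a b s. - \<epsilon> < b \<and> b < 0 \<and> 0 < a \<and> a < \<epsilon> \<and> s > 0 \<and>
        W a = s\<^sup>2 / 2 \<and> W b = s\<^sup>2 / 2 \<and> s / f a - s / f b = 2 / \<omega>"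
  shows "10 * A\<^sup>2 = 9 * \<omega>\<^sup>2 * B"
proof -
  define p q where "p = 2 * A / (3 * \<omega>\<^sup>2)" and "q = B / (2 * \<omega>\<^sup>2)"
  have W: "((\<lambda>u. (W u - \<omega>\<^sup>2 * u\<^sup>2 / 2 - A * u ^ 3 / 3) / u ^ 4) \<longlongrightarrow> B / 4) (at 0)"
  proof (rule lhopital[where f' = "\<lambda>u. f u - \<omega>\<^sup>2 * u - A * u\<^sup>2" and g' = "\<lambda>u. 4 * u ^ 3"])
    show "((\<lambda>u. W u - \<omega>\<^sup>2 * u\<^sup>2 / 2 - A * u ^ 3 / 3) \<longlongrightarrow> 0) (at 0)"
      using W0 by (auto intro!: tendsto_eq_intros)
    show "((\<lambda>u. u ^ 4) \<longlongrightarrow> (0::real)) (at 0)" by (auto intro!: tendsto_eq_intros)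
    show "\<forall>\<^sub>F u in at (0::real). u ^ 4 \<noteq> 0" "\<forall>\<^sub>F u in at (0::real). 4 * u ^ 3 \<noteq> 0"
      by (auto simp: eventually_at_filter)
    show "\<forall>\<^sub>F u in at 0. ((\<lambda>u. W u - \<omega>\<^sup>2 * u\<^sup>2 / 2 - A * u ^ 3 / 3) has_real_derivative
        f u - \<omega>\<^sup>2 * u - A * u\<^sup>2) (at u)"
      using W' by eventually_elim (auto intro!: derivative_eq_intros)
    show "\<forall>\<^sub>F u in at (0::real). ((\<lambda>u. u ^ 4) has_real_derivative 4 * u ^ 3) (at u)"
      by (auto intro!: always_eventually derivative_eq_intros)
    have "((\<lambda>u. (f u - \<omega>\<^sup>2 * u - A * u\<^sup>2) / u ^ 3 / 4) \<longlongrightarrow> B / 4) (at 0)"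
      by (rule tendsto_divide[OF f tendsto_const]) simp
    then show "((\<lambda>u. (f u - \<omega>\<^sup>2 * u - A * u\<^sup>2) / (4 * u ^ 3)) \<longlongrightarrow> B / 4) (at 0)"
      by (simp add: field_simps)
  qed
  define R S where "R u = 2 * W u / (\<omega> * u)\<^sup>2" and "S u = f u / (\<omega>\<^sup>2 * u)" for u
  define \<rho> \<sigma> where "\<rho> u = (R u - 1 - p * u) / u\<^sup>2" and "\<sigma> u = (S u - 1 - 3 / 2 * p * u) / u\<^sup>2" for u
  have ne: "\<forall>\<^sub>F u in at (0::real). u \<noteq> 0" by (auto simp: eventually_at_filter)
  have \<rho>: "(\<rho> \<longlongrightarrow> q) (at 0)"
  proof (rule Lim_transform_eventually)
    show "((\<lambda>u. 2 / \<omega>\<^sup>2 * ((W u - \<omega>\<^sup>2 * u\<^sup>2 / 2 - A * u ^ 3 / 3) / u ^ 4)) \<longlongrightarrow> q) (at 0)"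
      by (rule tendsto_eq_rhs[OF tendsto_mult[OF tendsto_const W]]) (simp add: q_def)
    show "\<forall>\<^sub>F u in at 0. 2 / \<omega>\<^sup>2 * ((W u - \<omega>\<^sup>2 * u\<^sup>2 / 2 - A * u ^ 3 / 3) / u ^ 4) = \<rho> u"
      using ne
    proof eventually_elim
      case (elim u)
      then show ?case using \<omega> unfolding \<rho>_def R_def p_def
        by (simp add: divide_simps) (simp add: algebra_simps power2_eq_square power3_eq_cube power4_eq_xxxx)
    qed
  qed
  have \<sigma>: "(\<sigma> \<longlongrightarrow> 2 * q) (at 0)"
  proof (rule Lim_transform_eventually)
    show "((\<lambda>u. 1 / \<omega>\<^sup>2 * ((f u - \<omega>\<^sup>2 * u - A * u\<^sup>2) / u ^ 3)) \<longlongrightarrow> 2 * q) (at 0)"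
      by (rule tendsto_eq_rhs[OF tendsto_mult[OF tendsto_const f]]) (simp add: q_def)
    show "\<forall>\<^sub>F u in at 0. 1 / \<omega>\<^sup>2 * ((f u - \<omega>\<^sup>2 * u - A * u\<^sup>2) / u ^ 3) = \<sigma> u"
      using ne
    proof eventually_elim
      case (elim u)
      then show ?case using \<omega> unfolding \<sigma>_def S_def p_def
        by (simp add: divide_simps) (simp add: algebra_simps power2_eq_square power3_eq_cube)
    qed
  qed
  have Req: "R u = 1 + u * (p + \<rho> u * u)" and Seq: "S u = 1 + u * (3 / 2 * p + \<sigma> u * u)" if "u \<noteq> 0" for u
    using that by (auto simp: \<rho>_def \<sigma>_def field_simps power2_eq_square)
  have R1: "(R \<longlongrightarrow> 1) (at 0)"
  proof (rule Lim_transform_eventually)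
    have "((\<lambda>u. 1 + u * (p + \<rho> u * u)) \<longlongrightarrow> 1 + 0 * (p + q * 0)) (at 0)"
      by (intro tendsto_intros \<rho>)
    then show "((\<lambda>u. 1 + u * (p + \<rho> u * u)) \<longlongrightarrow> 1) (at 0)" by simp
    show "\<forall>\<^sub>F u in at 0. 1 + u * (p + \<rho> u * u) = R u"
      using ne by eventually_elim (simp add: Req)
  qed
  have S1: "(S \<longlongrightarrow> 1) (at 0)"
  proof (rule Lim_transform_eventually)
    have "((\<lambda>u. 1 + u * (3 / 2 * p + \<sigma> u * u)) \<longlongrightarrow> 1 + 0 * (3 / 2 * p + 2 * q * 0)) (at 0)"
      by (intro tendsto_intros \<sigma>)
    then show "((\<lambda>u. 1 + u * (3 / 2 * p + \<sigma> u * u)) \<longlongrightarrow> 1) (at 0)" by simp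
    show "\<forall>\<^sub>F u in at 0. 1 + u * (3 / 2 * p + \<sigma> u * u) = S u"
      using ne by eventually_elim (simp add: Seq)
  qed
  define g where "g u = u * sqrt (R u)" for u
  define E where "E u = (sqrt (R u) / S u - 1 + p * g u) / u\<^sup>2" for u
  \<comment> \<open>\<open>N u * u^2\<close> is the difference \<open>R * (1 + p u S)^2 - S^2\<close> that appears when the numerator of \<open>E\<close>
    is freed from its square root; as a polynomial in \<open>u\<close>, \<open>\<rho>\<close>, \<open>\<sigma>\<close> and \<open>S\<close> it has an
    obvious limit.\<close>
  define N where "N u = (let e = 3 / 2 * p + \<sigma> u * u; Z = 2 * p * e + p\<^sup>2 * (S u)\<^sup>2 in
      \<rho> u * (1 + p * u * S u)\<^sup>2 + 2 * p\<^sup>2 + Z * (1 + p * u) - 2 * \<sigma> u - e\<^sup>2)" for u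
  have N: "(N \<longlongrightarrow> 15 / 4 * p\<^sup>2 - 3 * q) (at 0)"
  proof -
    have "(N \<longlongrightarrow> q * (1 + p * 0 * 1)\<^sup>2 + 2 * p\<^sup>2 +
        (2 * p * (3 / 2 * p + 2 * q * 0) + p\<^sup>2 * 1\<^sup>2) * (1 + p * 0) - 2 * (2 * q) -
        (3 / 2 * p + 2 * q * 0)\<^sup>2) (at 0)"
      unfolding N_def Let_def by (intro tendsto_intros \<rho> \<sigma> S1)
    then show ?thesis by (simp add: power2_eq_square algebra_simps)
  qed
  have E: "(E \<longlongrightarrow> (15 / 4 * p\<^sup>2 - 3 * q) / 2) (at 0)"
  proof (rule Lim_transform_eventually)
    have "((\<lambda>u. N u / (S u * (sqrt (R u) * (1 + p * u * S u) + S u))) \<longlongrightarrow>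
        (15 / 4 * p\<^sup>2 - 3 * q) / (1 * (sqrt 1 * (1 + p * 0 * 1) + 1))) (at 0)"
      by (intro tendsto_divide N tendsto_mult tendsto_add tendsto_real_sqrt R1 S1 tendsto_const tendsto_ident_at) simp
    then show "((\<lambda>u. N u / (S u * (sqrt (R u) * (1 + p * u * S u) + S u))) \<longlongrightarrow> (15 / 4 * p\<^sup>2 - 3 * q) / 2) (at 0)"
      by simp
    have M1: "((\<lambda>u. 1 + p * u * S u) \<longlongrightarrow> 1 + p * 0 * 1) (at 0)" by (intro tendsto_intros S1)
    have "\<forall>\<^sub>F u in at 0. 0 < R u \<and> 0 < S u \<and> 0 < 1 + p * u * S u \<and> u \<noteq> 0"
      using order_tendstoD(1)[OF R1, of 0] order_tendstoD(1)[OF S1, of 0] order_tendstoD(1)[OF M1, of 0] ne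
      by (simp add: eventually_conj_iff)
    then show "\<forall>\<^sub>F u in at 0. N u / (S u * (sqrt (R u) * (1 + p * u * S u) + S u)) = E u"
    proof eventually_elim
      case (elim u)
      define r where "r = sqrt (R u)"
      have r: "r > 0" "r\<^sup>2 = R u" using elim by (auto simp: r_def)
      define M where "M = 1 + p * u * S u"
      have den: "r * M + S u > 0" using elim r by (auto simp: M_def intro!: add_pos_pos)
      have "N u * u\<^sup>2 = R u * M\<^sup>2 - (S u)\<^sup>2"
      proof -
        define \<rho>' \<sigma>' where "\<rho>' = \<rho> u" and "\<sigma>' = \<sigma> u"
        have RS: "R u = 1 + u * (p + \<rho>' * u)" "S u = 1 + u * (3 / 2 * p + \<sigma>' * u)"
          using Req Seq elim by (auto simp: \<rho>'_def \<sigma>'_def)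
        show ?thesis unfolding N_def Let_def M_def \<rho>'_def[symmetric] \<sigma>'_def[symmetric] RS
          by algebra
      qed
      also have "\<dots> = (r * M + S u) * (r * M - S u)"
        unfolding r(2)[symmetric] by algebra
      finally have "N u = (r * M + S u) * (r * M - S u) / u\<^sup>2"
        using elim by (simp add: field_simps)
      then have "N u / (S u * (r * M + S u)) = (r * M - S u) / (u\<^sup>2 * S u)"
        using den by simp
      also have "\<dots> = E u"
        using elim by (simp add: E_def g_def r_def[symmetric] M_def divide_simps) (simp add: algebra_simps)
      finally show ?case by (simp add: r_def M_def)
    qed
  qed
  have key: "E a * a\<^sup>2 + E b * b\<^sup>2 = 0"
    if "b < 0" "0 < a" "s > 0" "W a = s\<^sup>2 / 2" "W b = s\<^sup>2 / 2" "s / f a - s / f b = 2 / \<omega>" for a b s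
  proof -
    have ra: "sqrt (R a) = s / (\<omega> * a)" and rb: "sqrt (R b) = - s / (\<omega> * b)"
    proof -
      have "R a = (s / (\<omega> * a))\<^sup>2" "R b = (s / (\<omega> * b))\<^sup>2"
        unfolding R_def that(4,5) by (simp_all add: power_divide)
      moreover have "s / (\<omega> * a) > 0" "s / (\<omega> * b) < 0"
        using that \<omega> by (auto simp: divide_pos_neg mult_pos_neg)
      ultimately show "sqrt (R a) = s / (\<omega> * a)" "sqrt (R b) = - s / (\<omega> * b)"
        by (simp_all only: real_sqrt_abs abs_of_pos abs_of_neg minus_divide_left)
    qed
    have "sqrt (R a) / S a = \<omega> * (s / f a)" "sqrt (R b) / S b = - \<omega> * (s / f b)"
      using that \<omega> unfolding ra rb S_def by (auto simp: power2_eq_square)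
    then have "sqrt (R a) / S a + sqrt (R b) / S b = \<omega> * (s / f a - s / f b)"
      by (simp add: algebra_simps)
    then have "sqrt (R a) / S a + sqrt (R b) / S b = 2" using that(6) \<omega> by simp
    moreover have "g a + g b = 0" using that \<omega> by (simp add: g_def ra rb)
    moreover have "E a * a\<^sup>2 + E b * b\<^sup>2 =
        (sqrt (R a) / S a + sqrt (R b) / S b) - 2 + p * (g a + g b)"
    proof -
      have "E u * u\<^sup>2 = sqrt (R u) / S u - 1 + p * g u" if "u \<noteq> 0" for u
        using that by (simp add: E_def)
      from this[of a] this[of b] show ?thesis using that(1,2) by (simp add: algebra_simps)
    qed
    ultimately show ?thesis by simp
  qed
  define c where "c = (15 / 4 * p\<^sup>2 - 3 * q) / 2"
  have "c = 0"
  proof (rule ccontr)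
    assume c: "c \<noteq> 0"
    have "((\<lambda>u. c * E u) \<longlongrightarrow> c * c) (at 0)"
      using E unfolding c_def by (intro tendsto_mult tendsto_const)
    moreover have "c * c > 0" using c zero_less_power2[of c] by (simp add: power2_eq_square)
    ultimately have "\<forall>\<^sub>F u in at 0. c * E u > 0" by (rule order_tendstoD(1))
    then obtain \<epsilon> where \<epsilon>: "\<epsilon> > 0" "\<And>u. u \<noteq> 0 \<Longrightarrow> \<bar>u\<bar> < \<epsilon> \<Longrightarrow> c * E u > 0"
      unfolding eventually_at by (auto simp: dist_real_def)
    obtain a b s where abs: "- \<epsilon> < b" "b < 0" "0 < a" "a < \<epsilon>" "s > 0"
        "W a = s\<^sup>2 / 2" "W b = s\<^sup>2 / 2" "s / f a - s / f b = 2 / \<omega>"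
      using pairs[OF \<epsilon>(1)] by blast
    have "c * E a * a\<^sup>2 > 0" "c * E b * b\<^sup>2 > 0" using \<epsilon>(2)[of a] \<epsilon>(2)[of b] abs by auto
    moreover have "c * E a * a\<^sup>2 + c * E b * b\<^sup>2 = 0"
      using key[OF abs(2,3,5,6,7,8)] by (metis distrib_left mult.assoc mult_zero_right)
    ultimately show False by linarith
  qed
  then have "5 * p\<^sup>2 = 4 * q" by (simp add: c_def)
  then show ?thesis using \<omega> unfolding p_def q_def
    by (simp add: divide_simps power2_eq_square) 
qed

lemma powr_expansion:
  fixes \<alpha> :: real
  shows "((\<lambda>u. ((1 + u) powr \<alpha> - 1 - \<alpha> * u - \<alpha> * (\<alpha> - 1) / 2 * u\<^sup>2) / u ^ 3)
     \<longlongrightarrow> \<alpha> * (\<alpha> - 1) * (\<alpha> - 2) / 6) (at 0)"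
  by real_asymp


section \<open>Two isochronous potentials\<close>

text \<open>
  Uniqueness comes from the energy of the difference of two solutions, which is constant.
\<close>

lemma harmonic_oscillator_unique:
  fixes u p :: "real \<Rightarrow> real"
  assumes J: "open J" "is_interval J" "t0 \<in> J" and \<omega>: "\<omega> \<noteq> 0"
    and u: "\<And>t. t \<in> J \<Longrightarrow> (u has_real_derivative \<omega> * p t) (at t)"
    and p: "\<And>t. t \<in> J \<Longrightarrow> (p has_real_derivative - \<omega> * u t) (at t)"
    and t: "t \<in> J"
  shows "u t = u t0 * cos (\<omega> * (t - t0)) + p t0 * sin (\<omega> * (t - t0))"
    and "p t = p t0 * cos (\<omega> * (t - t0)) - u t0 * sin (\<omega> * (t - t0))"
proof -
  define U P where "U t = u t0 * cos (\<omega> * (t - t0)) + p t0 * sin (\<omega> * (t - t0))"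
    and "P t = p t0 * cos (\<omega> * (t - t0)) - u t0 * sin (\<omega> * (t - t0))" for t
  define e where "e t = (u t - U t)\<^sup>2 + (p t - P t)\<^sup>2" for t
  have U': "(U has_real_derivative \<omega> * P t) (at t)" and P': "(P has_real_derivative - \<omega> * U t) (at t)" for t
    unfolding U_def P_def by (auto intro!: derivative_eq_intros simp: algebra_simps)
  have "(e has_real_derivative 0) (at t within J)" if "t \<in> J" for t
  proof -
    have "(e has_real_derivative 2 * (u t - U t) * (\<omega> * p t - \<omega> * P t)
        + 2 * (p t - P t) * (- \<omega> * u t - (- \<omega> * U t))) (at t)"
      unfolding e_def by (auto intro!: derivative_eq_intros u p U' P' that simp: algebra_simps)
    then have "(e has_real_derivative 0) (at t)" by (simp add: algebra_simps)
    then show ?thesis by (rule has_field_derivative_at_within)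
  qed
  moreover have "convex J" using J by (simp add: is_interval_convex)
  ultimately obtain c where "\<And>t. t \<in> J \<Longrightarrow> e t = c"
    using has_field_derivative_zero_constant by metis
  then have "e t = e t0" using J t by simp
  also have "\<dots> = 0" by (simp add: e_def U_def P_def)
  finally have "u t = U t \<and> p t = P t" by (simp add: e_def sum_power2_eq_zero_iff)
  then show "u t = u t0 * cos (\<omega> * (t - t0)) + p t0 * sin (\<omega> * (t - t0))"
    and "p t = p t0 * cos (\<omega> * (t - t0)) - u t0 * sin (\<omega> * (t - t0))"
    by (auto simp: U_def P_def)
qed

lemma rotation_norm:
  fixes a b :: real
  shows "(a * cos \<theta> + b * sin \<theta>)\<^sup>2 + (b * cos \<theta> - a * sin \<theta>)\<^sup>2 = a\<^sup>2 + b\<^sup>2"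
proof -
  have "(a * cos \<theta> + b * sin \<theta>)\<^sup>2 + (b * cos \<theta> - a * sin \<theta>)\<^sup>2 = (a\<^sup>2 + b\<^sup>2) * ((sin \<theta>)\<^sup>2 + (cos \<theta>)\<^sup>2)"
    by algebra
  then show ?thesis by simp
qed

text \<open>
  Used for minimality of the periods: a rotation with a nonzero fixed vector is a full number of
  turns.
\<close>

lemma rotation_fixes_vector:
  fixes a b :: real
  assumes "a * cos \<theta> + b * sin \<theta> = a" "b * cos \<theta> - a * sin \<theta> = b" "a \<noteq> 0 \<or> b \<noteq> 0"
    and "\<theta> > 0"
  shows "2 * pi \<le> \<theta>"
proof -
  have "(a\<^sup>2 + b\<^sup>2) * cos \<theta> = a * (a * cos \<theta> + b * sin \<theta>) + b * (b * cos \<theta> - a * sin \<theta>)"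
    by algebra
  also have "\<dots> = a\<^sup>2 + b\<^sup>2" unfolding assms(1,2) by (simp add: power2_eq_square)
  finally have "cos \<theta> = 1" using assms(3) by (auto simp: sum_power2_eq_zero_iff)
  then obtain n :: int where n: "\<theta> = n * 2 * pi" using cos_one_2pi_int by auto
  then have "n \<ge> 1" using assms(4) by (simp add: zero_less_mult_iff)
  then have "1 * (2 * pi) \<le> n * (2 * pi)" by (intro mult_right_mono) auto
  then show ?thesis using n by simp
qed

text \<open>
  The neighbourhood is the disc that touches the line \<open>x = 0\<close>: the orbits are circles around
  \<open>(k, 0)\<close>, and those inside this disc never leave the half-plane \<open>x > 0\<close>.
\<close>

lemma linear_potential_isochronous:
  fixes V :: "real \<Rightarrow> real"
  assumes V: "\<And>x. x > 0 \<Longrightarrow> deriv V x = x - k" and k: "k > 0"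
  shows "isochronous_around {0<..} (2 * pi) V k"
  unfolding isochronous_around_def
proof (intro exI conjI allI impI; (elim conjE bexE)?)
  show "open (ball (k, 0::real) k)" "(k, 0) \<in> ball (k, 0::real) k" using k by auto
next
  fix J x y t0
  assume max: "maximal_solution {0<..} V J x y" and t0: "t0 \<in> J"
    and U: "(x t0, y t0) \<in> ball (k, 0) k - {(k, 0)}"
  define a b where "a = x t0 - k" and "b = y t0"
  have ab: "a \<noteq> 0 \<or> b \<noteq> 0" using U by (auto simp: a_def b_def)
  have "sqrt (a\<^sup>2 + b\<^sup>2) < k"
    using U by (auto simp: a_def b_def dist_Pair_Pair dist_real_def power2_commute)
  then have "sqrt (a\<^sup>2 + b\<^sup>2) < sqrt (k\<^sup>2)" using k by simp
  then have "a\<^sup>2 + b\<^sup>2 < k\<^sup>2" by (simp only: real_sqrt_less_iff)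
  define X Y where "X t = k + (a * cos (t - t0) + b * sin (t - t0))"
    and "Y t = b * cos (t - t0) - a * sin (t - t0)" for t
  have J: "open J" "is_interval J" and s: "\<And>t. t \<in> J \<Longrightarrow> x t > 0"
      "\<And>t. t \<in> J \<Longrightarrow> (x has_real_derivative y t) (at t)"
      "\<And>t. t \<in> J \<Longrightarrow> (y has_real_derivative - deriv V (x t)) (at t)"
    using max by (auto simp: maximal_solution_def solution_def)
  have xX: "x t = X t \<and> y t = Y t" if "t \<in> J" for t
  proof -
    have "((\<lambda>t. x t - k) has_real_derivative 1 * y t) (at t)"
      "(y has_real_derivative - 1 * (x t - k)) (at t)" if "t \<in> J" for t
      using s[OF that] V[OF s(1)[OF that]] by (auto intro!: derivative_eq_intros)
    from harmonic_oscillator_unique[OF J t0 _ this \<open>t \<in> J\<close>] show ?thesis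
      by (simp add: X_def Y_def a_def b_def)
  qed
  have Xpos: "X t > 0" for t
  proof -
    have "(a * cos (t - t0) + b * sin (t - t0))\<^sup>2 \<le> a\<^sup>2 + b\<^sup>2"
      using rotation_norm[of a "t - t0" b] by (metis le_add_same_cancel1 zero_le_power2)
    then have "(a * cos (t - t0) + b * sin (t - t0))\<^sup>2 < k\<^sup>2" using \<open>a\<^sup>2 + b\<^sup>2 < k\<^sup>2\<close> by simp
    then have "\<bar>a * cos (t - t0) + b * sin (t - t0)\<bar> < k"
      using k by (metis abs_of_pos abs_square_less_1 power2_less_imp_less power2_abs less_imp_le)
    then show ?thesis by (auto simp: X_def)
  qed
  have "solution {0<..} V UNIV X Y"
    unfolding solution_def
  proof (intro conjI ballI)
    fix t
    show "X t \<in> {0<..}" using Xpos by simp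
    show "(X has_real_derivative Y t) (at t)"
      unfolding X_def Y_def by (auto intro!: derivative_eq_intros)
    show "(Y has_real_derivative - deriv V (X t)) (at t)"
      unfolding V[OF Xpos] unfolding X_def Y_def by (auto intro!: derivative_eq_intros)
  qed auto
  moreover have "\<forall>t\<in>J. X t = x t \<and> Y t = y t" using xX by simp
  ultimately have "UNIV = J"
    using max[unfolded maximal_solution_def, THEN conjunct2, rule_format, of UNIV X Y] by simp
  then have JU: "J = UNIV" by simp
  then have eq: "x = X" "y = Y" by (auto simp: fun_eq_iff xX JU)
  have "has_minimal_period (\<lambda>t. (X t, Y t)) (2 * pi)"
    unfolding has_minimal_period_def
  proof (intro conjI allI impI notI)
    fix t
    have "t + 2 * pi - t0 = t - t0 + 2 * pi" by simp
    then show "(X (t + 2 * pi), Y (t + 2 * pi)) = (X t, Y t)"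
      by (simp only: X_def Y_def cos_periodic sin_periodic)
  next
    fix S assume S: "0 < S \<and> S < 2 * pi" and "\<forall>t. (X (t + S), Y (t + S)) = (X t, Y t)"
    then have "(X (t0 + S), Y (t0 + S)) = (X t0, Y t0)" by blast
    then have "2 * pi \<le> S" using rotation_fixes_vector[of a S b] ab S by (simp add: X_def Y_def)
    then show False using S by simp
  qed simp
  then show "J = UNIV" "has_minimal_period (\<lambda>t. (x t, y t)) (2 * pi)" using JU eq by auto
qed

text \<open>
  Let \<open>h\<close> be the conserved quantity \<open>x^2 + y^2 + m / x^2\<close>, twice the energy. Then
  \<open>u = x^2 - h / 2\<close> and \<open>p = x * y\<close> satisfy \<open>u' = 2 p\<close> and \<open>p' = - 2 u\<close>, so \<open>x^2\<close> is
  determined by its initial data and has period \<open>\<pi>\<close>. The amplitude satisfies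
  \<open>a^2 + b^2 = h^2 / 4 - m\<close>; as \<open>m > 0\<close>, the square \<open>x^2\<close> stays positive, and every
  solution is global. The neighbourhood can be the whole plane.
\<close>

lemma inverse_square_potential_isochronous:
  fixes V :: "real \<Rightarrow> real"
  assumes V: "\<And>x. x > 0 \<Longrightarrow> deriv V x = x - m / x ^ 3" and m: "m > 0"
    and x0: "x0 > 0" "x0 ^ 4 = m"
  shows "isochronous_around {0<..} pi V x0"
  unfolding isochronous_around_def
proof (intro exI conjI allI impI; (elim conjE bexE)?)
  show "open (UNIV :: (real \<times> real) set)" "(x0, 0) \<in> (UNIV :: (real \<times> real) set)" by auto
next
  fix J x y t0
  assume max: "maximal_solution {0<..} V J x y" and t0: "t0 \<in> J"
    and U: "(x t0, y t0) \<in> UNIV - {(x0, 0)}"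
  have J: "open J" "is_interval J" and s: "\<And>t. t \<in> J \<Longrightarrow> x t > 0"
      "\<And>t. t \<in> J \<Longrightarrow> (x has_real_derivative y t) (at t)"
      "\<And>t. t \<in> J \<Longrightarrow> (y has_real_derivative - deriv V (x t)) (at t)"
    using max by (auto simp: maximal_solution_def solution_def)
  define H where "H t = (x t)\<^sup>2 + (y t)\<^sup>2 + m / (x t)\<^sup>2" for t
  define h where "h = H t0"
  have Hconst: "H t = h" if "t \<in> J" for t
  proof -
    have "(H has_real_derivative 0) (at t within J)" if t: "t \<in> J" for t
    proof -
      have "(H has_real_derivative 2 * x t * y t + 2 * y t * (- deriv V (x t)) - m * (2 * x t * y t) / ((x t)\<^sup>2)\<^sup>2) (at t)"
        unfolding H_def using s(1)[OF t]
        by (auto intro!: derivative_eq_intros s t simp: power2_eq_square)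
      moreover have "2 * x t * y t + 2 * y t * (- deriv V (x t)) - m * (2 * x t * y t) / ((x t)\<^sup>2)\<^sup>2 = 0"
        unfolding V[OF s(1)[OF t]] using s(1)[OF t] by (simp add: field_simps eval_nat_numeral)
      ultimately show ?thesis by (simp add: has_field_derivative_at_within)
    qed
    moreover have "convex J" using J by (simp add: is_interval_convex)
    ultimately obtain c where "\<And>t. t \<in> J \<Longrightarrow> H t = c"
      using has_field_derivative_zero_constant by metis
    then show ?thesis using that t0 by (simp add: h_def)
  qed
  define a b where "a = (x t0)\<^sup>2 - h / 2" and "b = x t0 * y t0"
  have amp: "a\<^sup>2 + b\<^sup>2 = h\<^sup>2 / 4 - m"
  proof -
    have "(x t0)\<^sup>2 * h = (x t0)\<^sup>2 * (x t0)\<^sup>2 + (x t0)\<^sup>2 * (y t0)\<^sup>2 + m"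
      using s(1)[OF t0] by (simp add: h_def H_def algebra_simps)
    then show ?thesis by (simp add: a_def b_def power2_eq_square algebra_simps)
  qed
  have ab: "a \<noteq> 0 \<or> b \<noteq> 0"
  proof (rule ccontr)
    assume "\<not> ?thesis"
    then have y: "y t0 = 0" and "(x t0)\<^sup>2 = m / (x t0)\<^sup>2"
      using s(1)[OF t0] by (auto simp: a_def b_def h_def H_def)
    then have "x t0 ^ 4 = x0 ^ 4" using x0 s(1)[OF t0] by (simp add: field_simps eval_nat_numeral)
    then have "x t0 = x0" using s(1)[OF t0] x0 power_eq_iff_eq_base[of 4 "x t0" x0] by simp
    then show False using U y by simp
  qed
  \<comment> \<open>\<open>Z\<close> and \<open>P\<close> are the candidates for \<open>x^2\<close> and \<open>x * y\<close> at all times, also outside the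
    interval of definition of the given solution.\<close>
  define Z P where "Z t = h / 2 + (a * cos (2 * (t - t0)) + b * sin (2 * (t - t0)))"
    and "P t = b * cos (2 * (t - t0)) - a * sin (2 * (t - t0))" for t
  have Z': "(Z has_real_derivative 2 * P t) (at t)" and P': "(P has_real_derivative - 2 * (Z t - h / 2)) (at t)" for t
    unfolding Z_def P_def by (auto intro!: derivative_eq_intros simp: algebra_simps)
  have ZP: "(Z t)\<^sup>2 + (P t)\<^sup>2 = h * Z t - m" for t
  proof -
    have "(Z t - h / 2)\<^sup>2 + (P t)\<^sup>2 = h\<^sup>2 / 4 - m"
      using rotation_norm[of a "2 * (t - t0)" b] amp by (simp add: Z_def P_def)
    then show ?thesis by (simp add: power2_eq_square algebra_simps)
  qed
  have xZ: "(x t)\<^sup>2 = Z t \<and> x t * y t = P t" if t: "t \<in> J" for t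
  proof -
    have "((\<lambda>t. (x t)\<^sup>2 - h / 2) has_real_derivative 2 * (x t * y t)) (at t)"
      "((\<lambda>t. x t * y t) has_real_derivative - 2 * ((x t)\<^sup>2 - h / 2)) (at t)" if t: "t \<in> J" for t
    proof -
      show "((\<lambda>t. (x t)\<^sup>2 - h / 2) has_real_derivative 2 * (x t * y t)) (at t)"
        by (auto intro!: derivative_eq_intros s t)
      have "((\<lambda>t. x t * y t) has_real_derivative x t * (- deriv V (x t)) + y t * y t) (at t)"
        by (auto intro!: derivative_eq_intros s t)
      moreover have "x t * (- deriv V (x t)) + y t * y t = - 2 * ((x t)\<^sup>2 - h / 2)"
        unfolding V[OF s(1)[OF t]] Hconst[OF t, symmetric] H_def using s(1)[OF t]
        by (simp add: field_simps eval_nat_numeral)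
      ultimately show "((\<lambda>t. x t * y t) has_real_derivative - 2 * ((x t)\<^sup>2 - h / 2)) (at t)" by simp
    qed
    from harmonic_oscillator_unique[OF J t0 _ this t] show ?thesis
      by (simp add: Z_def P_def a_def b_def)
  qed
  have hpos: "h > 0" 
  proof -
    have "(x t0)\<^sup>2 > 0" "m / (x t0)\<^sup>2 > 0" using s(1)[OF t0] m by auto
    then show ?thesis unfolding h_def H_def using zero_le_power2[of "y t0"] by linarith
  qed
  have Zpos: "Z t > 0" for t
  proof -
    have "h * Z t = (Z t)\<^sup>2 + (P t)\<^sup>2 + m" using ZP[of t] by simp
    also have "\<dots> > 0" using m by (intro add_nonneg_pos add_nonneg_nonneg) auto
    finally show ?thesis using hpos by (simp add: zero_less_mult_iff)
  qed
  define X Y where "X t = sqrt (Z t)" and "Y t = P t / sqrt (Z t)" for t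
  have Xpos: "X t > 0" and Xsq: "(X t)\<^sup>2 = Z t" and XY: "X t * Y t = P t" for t
    using Zpos[of t] by (auto simp: X_def Y_def)
  have xX: "x t = X t \<and> y t = Y t" if t: "t \<in> J" for t
  proof -
    have "x t = X t" unfolding X_def using xZ[OF t] s(1)[OF t] by (metis less_imp_le real_sqrt_unique)
    moreover from this have "X t * y t = X t * Y t" using xZ[OF t] XY[of t] by simp
    ultimately show ?thesis using Xpos[of t] by simp
  qed
  have X': "(X has_real_derivative Y t) (at t)" for t
    unfolding X_def using Zpos[of t]
    by (auto intro!: derivative_eq_intros Z' simp: Y_def field_simps)
  have "solution {0<..} V UNIV X Y"
    unfolding solution_def
  proof (intro conjI ballI)
    fix t
    show "X t \<in> {0<..}" using Xpos by simp
    show "(X has_real_derivative Y t) (at t)" by (rule X')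
    have Yeq: "Y = (\<lambda>t. P t / X t)" by (auto simp: X_def Y_def)
    have "((\<lambda>t. P t / X t) has_real_derivative
        (- 2 * (Z t - h / 2) * X t - P t * Y t) / (X t * X t)) (at t)"
      using Xpos[of t] by (auto intro!: derivative_eq_intros P' X')
    moreover have "(- 2 * (Z t - h / 2) * X t - P t * Y t) / (X t * X t) = - (X t - m / X t ^ 3)"
    proof -
      have "m = (h - (X t)\<^sup>2 - (Y t)\<^sup>2) * (X t)\<^sup>2"
        using ZP[of t] unfolding Xsq[symmetric] XY[symmetric] by algebra
      then have "m / X t ^ 3 = (h - (X t)\<^sup>2 - (Y t)\<^sup>2) / X t"
        using Xpos[of t] by (simp add: power2_eq_square power3_eq_cube)
      then have "- (X t - m / X t ^ 3) = (h - 2 * (X t)\<^sup>2 - (Y t)\<^sup>2) / X t"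
        using Xpos[of t] by (simp add: field_simps power2_eq_square)
      moreover have "(- 2 * (Z t - h / 2) * X t - P t * Y t) / (X t * X t) =
          (h - 2 * (X t)\<^sup>2 - (Y t)\<^sup>2) / X t"
        unfolding Xsq[symmetric] XY[symmetric] using Xpos[of t]
        by (simp add: field_simps power2_eq_square)
      ultimately show ?thesis by (simp only:)
    qed
    ultimately show "(Y has_real_derivative - deriv V (X t)) (at t)"
      unfolding V[OF Xpos] unfolding Yeq by simp
  qed auto
  moreover have "\<forall>t\<in>J. X t = x t \<and> Y t = y t" using xX by simp
  ultimately have "UNIV = J"
    using max[unfolded maximal_solution_def, THEN conjunct2, rule_format, of UNIV X Y] by simp
  then have JU: "J = UNIV" by simp
  then have eq: "x = X" "y = Y" by (auto simp: fun_eq_iff xX JU)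
  have "has_minimal_period (\<lambda>t. (X t, Y t)) pi"
    unfolding has_minimal_period_def
  proof (intro conjI allI impI notI)
    fix t
    have "2 * (t + pi - t0) = 2 * (t - t0) + 2 * pi" by simp
    then show "(X (t + pi), Y (t + pi)) = (X t, Y t)"
      by (simp only: X_def Y_def Z_def P_def cos_periodic sin_periodic)
  next
    fix S assume S: "0 < S \<and> S < pi" and "\<forall>t. (X (t + S), Y (t + S)) = (X t, Y t)"
    then have *: "X (t0 + S) = X t0" "Y (t0 + S) = Y t0" by auto
    then have "Z (t0 + S) = Z t0" "P (t0 + S) = P t0" by (metis Xsq, metis * XY)
    then have "2 * pi \<le> 2 * S" using rotation_fixes_vector[of a "2 * S" b] ab S by (simp add: Z_def P_def)
    then show False using S by simp
  qed simp
  then show "J = UNIV" "has_minimal_period (\<lambda>t. (x t, y t)) pi" using JU eq by auto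
qed


section \<open>Families over the half-line\<close>

lemma C2_on_second_derivative:
  assumes "C2_on I \<Phi>"
  obtains D2 where "continuous_on I D2"
    "\<And>x. x \<in> I \<Longrightarrow> (deriv \<Phi> has_real_derivative D2 x) (at x)"
    "\<And>x. x \<in> I \<Longrightarrow> (\<Phi> has_real_derivative deriv \<Phi> x) (at x)"
proof -
  obtain D2 where D2: "\<And>x. x \<in> I \<Longrightarrow> (deriv \<Phi> has_vector_derivative D2 x) (at x)" "continuous_on I D2"
    using assms unfolding C2_on_def C1_differentiable_on_def by metis
  have "(\<Phi> has_real_derivative deriv \<Phi> x) (at x)" if "x \<in> I" for x
    using assms that unfolding C2_on_def
    by (simp add: DERIV_deriv_iff_real_differentiable)
  with D2 that show ?thesis by (simp add: has_real_derivative_iff_has_vector_derivative)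
qed

lemma family_derivative:
  fixes \<Phi> V0 :: "real \<Rightarrow> real"
  assumes C2: "C2_on {0<..} \<Phi>"
    and V0: "\<And>x. x > 0 \<Longrightarrow> V0 x = x\<^sup>2 / 2 + lam * \<Phi> x"
    and x: "x > 0"
  shows "(V0 has_real_derivative x + lam * deriv \<Phi> x) (at x)"
    and "deriv V0 x = x + lam * deriv \<Phi> x"
proof -
  obtain D2 where \<Phi>': "\<And>x. x \<in> {0<..} \<Longrightarrow> (\<Phi> has_real_derivative deriv \<Phi> x) (at x)"
    by (rule C2_on_second_derivative[OF C2]) blast
  have "((\<lambda>x. x\<^sup>2 / 2 + lam * \<Phi> x) has_real_derivative x + lam * deriv \<Phi> x) (at x)"
    using x by (auto intro!: derivative_eq_intros \<Phi>')
  then show *: "(V0 has_real_derivative x + lam * deriv \<Phi> x) (at x)"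
    by (rule has_field_derivative_transform_within_open[of _ _ _ "{0<..}"]) (auto simp: x V0)
  then show "deriv V0 x = x + lam * deriv \<Phi> x" by (rule DERIV_imp_deriv)
qed

lemma family_C2:
  fixes \<Phi> V0 :: "real \<Rightarrow> real"
  assumes C2: "C2_on {0<..} \<Phi>"
    and V0: "\<And>x. x > 0 \<Longrightarrow> V0 x = x\<^sup>2 / 2 + lam * \<Phi> x"
  shows "C2_on {0<..} V0"
proof -
  obtain D2 where D2: "continuous_on {0<..} D2"
    "\<And>x. x \<in> {0<..} \<Longrightarrow> (deriv \<Phi> has_real_derivative D2 x) (at x)"
    by (rule C2_on_second_derivative[OF C2]) blast
  have "(deriv V0 has_real_derivative 1 + lam * D2 x) (at x)" if x: "x > 0" for x
  proof -
    have "((\<lambda>x. x + lam * deriv \<Phi> x) has_real_derivative 1 + lam * D2 x) (at x)"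
      using x by (auto intro!: derivative_eq_intros D2)
    then show ?thesis
      by (rule has_field_derivative_transform_within_open[of _ _ _ "{0<..}"])
        (auto simp: x family_derivative(2)[OF C2 V0])
  qed
  moreover have "continuous_on {0<..} (\<lambda>x. 1 + lam * D2 x)"
    by (intro continuous_intros D2)
  moreover have "V0 differentiable at x" if "x > 0" for x
    using family_derivative(1)[OF C2 V0 that] real_differentiable_def by blast
  ultimately show ?thesis
    unfolding C2_on_def C1_differentiable_on_def
    by (auto simp: has_real_derivative_iff_has_vector_derivative intro!: exI[of _ "\<lambda>x. 1 + lam * D2 x"])
qed

text \<open>
  At a point with \<open>\<Phi>' x < 0\<close> the potential with parameter \<open>- x / \<Phi>' x\<close> has an equilibrium, and
  \<open>1 - x * \<Phi>'' x / \<Phi>' x\<close> is the second derivative of this potential there. This transfers the local results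
  to \<open>\<Phi>\<close>.
\<close>

lemma family_frequency:
  fixes \<Phi> :: "real \<Rightarrow> real" and V :: "real \<Rightarrow> real \<Rightarrow> real"
  assumes C2: "C2_on {0<..} \<Phi>"
    and V: "\<And>lam x. lam > 0 \<Longrightarrow> x > 0 \<Longrightarrow> V lam x = x\<^sup>2 / 2 + lam * \<Phi> x"
    and fam: "isochronous_family {0<..} T V"
    and x: "x > 0" "deriv \<Phi> x < 0"
    and D2: "continuous_on {0<..} D2" "\<And>x. x > 0 \<Longrightarrow> (deriv \<Phi> has_real_derivative D2 x) (at x)"
  shows "1 - x * D2 x / deriv \<Phi> x \<ge> 0"
    and "1 - x * D2 x / deriv \<Phi> x > 0 \<Longrightarrow> T = 2 * pi / sqrt (1 - x * D2 x / deriv \<Phi> x)"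
    and "1 - x * D2 x / deriv \<Phi> x > 0 \<Longrightarrow> \<epsilon> > 0 \<Longrightarrow>
      \<exists>a b s. x - \<epsilon> < b \<and> b < x \<and> x < a \<and> a < x + \<epsilon> \<and> s > 0 \<and>
        V (- x / deriv \<Phi> x) a - V (- x / deriv \<Phi> x) x = s\<^sup>2 / 2 \<and>
        V (- x / deriv \<Phi> x) b - V (- x / deriv \<Phi> x) x = s\<^sup>2 / 2 \<and>
        s / (a - x / deriv \<Phi> x * deriv \<Phi> a) - s / (b - x / deriv \<Phi> x * deriv \<Phi> b) = T / pi"
proof -
  define lam where "lam = - x / deriv \<Phi> x"
  define f where "f z = z + lam * deriv \<Phi> z" for z
  define v where "v = 1 + lam * D2 x"
  have lam: "lam > 0" using x by (simp add: lam_def divide_pos_neg divide_neg_neg)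
  have V': "(V lam has_real_derivative f z) (at z)" "deriv (V lam) z = f z" if "z \<in> {0<..}" for z
    using family_derivative[OF C2 V[OF lam]] that by (auto simp: f_def)
  have f0: "f x = 0" using x by (simp add: f_def lam_def)
  then have "equilibrium {0<..} (V lam) x" using V'(2) x by (simp add: equilibrium_def)
  then have iso: "isochronous_around {0<..} T (V lam) x"
    using fam lam unfolding isochronous_family_def by blast
  have f': "(f has_real_derivative v) (at x)"
    unfolding f_def v_def using x by (auto intro!: derivative_eq_intros D2)
  have "continuous_on {0<..} (deriv \<Phi>)"
    using D2(2) by (meson DERIV_isCont continuous_at_imp_continuous_on greaterThan_iff)
  then have fcont: "continuous_on {0<..} f"
    unfolding f_def by (intro continuous_intros)
  have veq: "1 - x * D2 x / deriv \<Phi> x = v" by (simp add: v_def lam_def)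
  have feq: "z - x / deriv \<Phi> x * deriv \<Phi> z = f z" for z by (simp add: f_def lam_def)
  have I: "open {0::real<..}" "x \<in> {0<..}" using x by auto
  show "1 - x * D2 x / deriv \<Phi> x \<ge> 0"
    unfolding veq by (rule no_isochronous_saddle[OF iso I V'(1) f0 f'])
  show "T = 2 * pi / sqrt (1 - x * D2 x / deriv \<Phi> x)" if "1 - x * D2 x / deriv \<Phi> x > 0"
    using that centre_frequency[OF iso I V'(1) fcont f0 f'] unfolding veq by simp
  show "\<exists>a b s. x - \<epsilon> < b \<and> b < x \<and> x < a \<and> a < x + \<epsilon> \<and> s > 0 \<and>
        V (- x / deriv \<Phi> x) a - V (- x / deriv \<Phi> x) x = s\<^sup>2 / 2 \<and>
        V (- x / deriv \<Phi> x) b - V (- x / deriv \<Phi> x) x = s\<^sup>2 / 2 \<and>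
        s / (a - x / deriv \<Phi> x * deriv \<Phi> a) - s / (b - x / deriv \<Phi> x * deriv \<Phi> b) = T / pi"
    if "1 - x * D2 x / deriv \<Phi> x > 0" "\<epsilon> > 0"
    using that period_of_centre[OF iso I V'(1) fcont f0 f'] unfolding veq feq lam_def[symmetric]
    by simp
qed

text \<open>
  The second derivative \<open>v\<close> of the potential at its equilibrium takes only the values \<open>0\<close> and
  \<open>w = (2 * \<pi> / T)^2\<close>, and it is continuous. The value \<open>0\<close> is excluded because \<open>v\<close> would
  vanish on a neighbourhood, where \<open>\<Phi>' z / z\<close> would then be constant; all points of the
  neighbourhood would be equilibria of the same potential. With \<open>v = w\<close>, the function
  \<open>p x = \<Phi>' x * x powr (w - 1)\<close> has derivative \<open>0\<close> wherever it is negative, so its level set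
  through a point with \<open>\<Phi>' < 0\<close> is open and closed in the half-line.
\<close>

theorem isochronous_family_power_law:
  fixes \<Phi> :: "real \<Rightarrow> real" and V :: "real \<Rightarrow> real \<Rightarrow> real"
  assumes C2: "C2_on {0<..} \<Phi>"
    and V: "\<And>lam x. lam > 0 \<Longrightarrow> x > 0 \<Longrightarrow> V lam x = x\<^sup>2 / 2 + lam * \<Phi> x"
    and fam: "isochronous_family {0<..} T V" and T: "T > 0"
  shows "\<exists>K<0. \<forall>x>0. deriv \<Phi> x = K * x powr (1 - (2 * pi / T)\<^sup>2)"
proof -
  define D where "D = deriv \<Phi>"
  define w where "w = (2 * pi / T)\<^sup>2"
  have w: "w > 0" using T by (simp add: w_def)
  obtain D2 where D2: "continuous_on {0<..} D2"
    "\<And>x. x \<in> {0<..} \<Longrightarrow> (deriv \<Phi> has_real_derivative D2 x) (at x)"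
    by (rule C2_on_second_derivative[OF C2]) blast
  have D': "(D has_real_derivative D2 x) (at x)" if "x > 0" for x using D2 that by (simp add: D_def)
  have Dcont: "isCont D x" if "x > 0" for x using DERIV_isCont[OF D'[OF that]] .
  have D2cont: "isCont D2 x" if "x > 0" for x
    using D2(1) that by (simp add: continuous_on_eq_continuous_at)
  define v where "v x = 1 - x * D2 x / D x" for x
  have v_cases: "v x = 0 \<or> v x = w" if "x > 0" "D x < 0" for x
  proof (cases "v x = 0")
    case False
    have "v x \<ge> 0" "v x > 0 \<Longrightarrow> T = 2 * pi / sqrt (v x)"
      using family_frequency(1,2)[OF C2 V fam that[unfolded D_def] D2(1) D'[unfolded D_def]]
      by (simp_all add: v_def D_def)
    with False have "v x > 0" "T = 2 * pi / sqrt (v x)" by auto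
    then have "2 * pi / T = sqrt (v x)" by simp
    then show ?thesis using \<open>v x > 0\<close> by (simp add: w_def)
  qed simp
  have v_eq: "v x = w" if x: "x > 0" "D x < 0" for x
  proof (rule ccontr)
    assume "v x \<noteq> w"
    then have v0: "v x = 0" using v_cases[OF x] by simp
    have "isCont v x" unfolding v_def using Dcont D2cont x by (intro continuous_intros) auto
    then have "(v \<longlongrightarrow> v x) (nhds x)" by (simp add: isCont_def tendsto_at_iff_tendsto_nhds)
    then have "\<forall>\<^sub>F z in nhds x. v z < w" using v0 w by (simp add: order_tendstoD(2))
    moreover have "\<forall>\<^sub>F z in nhds x. D z < 0"
      using Dcont[OF x(1)] x(2) by (auto simp: continuous_within tendsto_at_iff_tendsto_nhds intro: order_tendstoD(2))
    moreover have "\<forall>\<^sub>F z in nhds x. z > 0"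
      using x(1) eventually_nhds_in_open[of "{0<..}" x] by simp
    ultimately have "\<forall>\<^sub>F z in nhds x. v z < w \<and> D z < 0 \<and> z > 0" by eventually_elim simp
    then obtain e where e: "e > 0" "\<And>z. dist z x < e \<Longrightarrow> v z < w \<and> D z < 0 \<and> z > 0"
      unfolding eventually_nhds_metric by blast
    have "((\<lambda>z. D z / z) has_real_derivative 0) (at z within ball x e)" if z: "z \<in> ball x e" for z
    proof -
      have z': "v z < w" "D z < 0" "z > 0" using e(2)[of z] z by (auto simp: dist_commute)
      then have "v z = 0" using v_cases[of z] by auto
      then have "D z = z * D2 z" using z' by (simp add: v_def field_simps)
      have "((\<lambda>z. D z / z) has_real_derivative (D2 z * z - D z * 1) / (z * z)) (at z)"
        using z' by (auto intro!: derivative_eq_intros D')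
      then show ?thesis using \<open>D z = z * D2 z\<close> by (simp add: mult.commute has_field_derivative_at_within)
    qed
    then obtain q where q: "\<And>z. z \<in> ball x e \<Longrightarrow> D z / z = q"
      using has_field_derivative_zero_constant[OF convex_ball, of x e "\<lambda>z. D z / z"] by blast
    define z where "z = x + e / 2"
    have z: "z \<in> ball x e" "x \<in> ball x e" "z \<noteq> x" "z > 0" using e x by (auto simp: z_def dist_real_def)
    have Dq: "D z = q * z" "D x = q * x" using q[OF z(1)] q[OF z(2)] z x by (auto simp: field_simps)
    then have "q < 0" using x by (simp add: mult_less_0_iff)
    then have lam: "- 1 / q > 0" by simp
    have "equilibrium {0<..} (V (- 1 / q)) z" "equilibrium {0<..} (V (- 1 / q)) x"
      using family_derivative(2)[OF C2 V[OF lam]] Dq z x \<open>q < 0\<close>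
      by (auto simp: equilibrium_def D_def)
    then have "z = x" using fam lam unfolding isochronous_family_def by blast
    then show False using z by simp
  qed
  define p where "p x = D x * x powr (w - 1)" for x
  have p': "(p has_real_derivative 0) (at x)" if x: "x > 0" "D x < 0" for x
  proof -
    have "x * D2 x = (1 - w) * D x"
      using v_eq[OF x] x by (simp add: v_def field_simps)
    then have "x * D2 x + (w - 1) * D x = 0" by (simp add: algebra_simps)
    moreover have "x powr (w - 1) = x * x powr (w - 2)"
      using x powr_add[of x 1 "w - 2"] by simp
    then have "D2 x * x powr (w - 1) + (w - 1) * x powr (w - 2) * D x =
        x powr (w - 2) * (x * D2 x + (w - 1) * D x)"
      by (simp add: algebra_simps)
    ultimately have "D2 x * x powr (w - 1) + (w - 1) * x powr (w - 2) * D x = 0" by simp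
    moreover have "(p has_real_derivative D2 x * x powr (w - 1) + (w - 1) * x powr (w - 1 - 1) * D x) (at x)"
      unfolding p_def using x by (auto intro!: derivative_eq_intros D')
    ultimately show ?thesis by simp
  qed
  obtain x0 where x0: "x0 > 0" "D x0 < 0"
  proof -
    obtain lam x where l: "lam > 0" "equilibrium {0<..} (V lam) x"
      using fam unfolding isochronous_family_def by blast
    then have "x > 0" "x + lam * D x = 0"
      using family_derivative(2)[OF C2 V[OF l(1)]] by (auto simp: equilibrium_def D_def)
    then have "D x < 0" using l by (smt (verit) mult_nonneg_nonneg)
    with \<open>x > 0\<close> that show ?thesis by blast
  qed
  define K where "K = p x0"
  have K: "K < 0" using x0 by (simp add: K_def p_def mult_neg_pos)
  have pcont: "continuous_on {0<..} p"
    unfolding p_def using Dcont by (intro continuous_intros continuous_at_imp_continuous_on) auto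
  define S where "S = {x \<in> {0<..}. p x = K}"
  have "closedin (top_of_set {0<..}) S"
    unfolding S_def by (rule continuous_closedin_preimage_constant[OF pcont])
  moreover have "open S"
    unfolding open_dist
  proof
    fix x assume "x \<in> S"
    then have x: "x > 0" "p x = K" by (auto simp: S_def)
    have "isCont p x" using pcont x by (simp add: continuous_on_eq_continuous_at)
    then have "\<forall>\<^sub>F z in nhds x. p z < 0"
      using K x by (auto simp: continuous_within tendsto_at_iff_tendsto_nhds intro: order_tendstoD(2))
    moreover have "\<forall>\<^sub>F z in nhds x. z > 0"
      using x(1) eventually_nhds_in_open[of "{0<..}" x] by simp
    ultimately have "\<forall>\<^sub>F z in nhds x. p z < 0 \<and> z > 0" by eventually_elim simp
    then obtain e where e: "e > 0" "\<And>z. dist z x < e \<Longrightarrow> p z < 0 \<and> z > 0"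
      unfolding eventually_nhds_metric by blast
    have "(p has_real_derivative 0) (at z within ball x e)" if "z \<in> ball x e" for z
    proof -
      have "z > 0" "p z < 0" using e(2)[of z] that by (auto simp: dist_commute)
      then show ?thesis using p'[of z]
        by (auto simp: p_def mult_less_0_iff has_field_derivative_at_within)
    qed
    then obtain c where "\<And>z. z \<in> ball x e \<Longrightarrow> p z = c"
      using has_field_derivative_zero_constant[OF convex_ball, of x e p] by blast
    then have "p z = K" if "dist z x < e" for z
      using that e(1) x(2) by (metis centre_in_ball dist_commute mem_ball)
    then show "\<exists>e>0. \<forall>z. dist z x < e \<longrightarrow> z \<in> S"
      using e by (auto simp: S_def)
  qed
  then have "openin (top_of_set {0<..}) S"
    by (intro open_subset) (auto simp: S_def)
  moreover have "connected {0::real<..}" by (rule connected_Ioi)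
  moreover have "x0 \<in> S" using x0 by (simp add: S_def K_def)
  ultimately have S: "S = {0<..}" unfolding connected_clopen by blast
  have "D x = K * x powr (1 - w)" if "x > 0" for x
  proof -
    have "p x = K" using S that by (auto simp: S_def)
    moreover have "x powr (w - 1) * x powr (1 - w) = 1"
      using that by (simp add: powr_add[symmetric])
    ultimately show ?thesis unfolding p_def by (metis mult.assoc mult.right_neutral)
  qed
  with K show ?thesis by (auto simp: D_def w_def)
qed

text \<open>
  The parameter \<open>- 1 / K\<close> places the equilibrium at \<open>1\<close>, where the derivative
  of the potential is \<open>(1 + u) - (1 + u) powr \<alpha>\<close>. Its Taylor coefficients turn the second-order condition into
  \<open>(\<alpha> - 1)^2 * \<alpha> * (\<alpha> + 3) = 0\<close>.
\<close>

theorem isochronous_power_exponent: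
  fixes \<Phi> :: "real \<Rightarrow> real" and V :: "real \<Rightarrow> real \<Rightarrow> real"
  assumes C2: "C2_on {0<..} \<Phi>"
    and V: "\<And>lam x. lam > 0 \<Longrightarrow> x > 0 \<Longrightarrow> V lam x = x\<^sup>2 / 2 + lam * \<Phi> x"
    and fam: "isochronous_family {0<..} T V"
    and \<alpha>: "\<alpha> < 1" and K: "K < 0" and power: "\<And>x. x > 0 \<Longrightarrow> deriv \<Phi> x = K * x powr \<alpha>"
  shows "(\<alpha> = 0 \<or> \<alpha> = - 3) \<and> T = 2 * pi / sqrt (1 - \<alpha>)"
proof -
  obtain D2 where D2: "continuous_on {0<..} D2"
    "\<And>x. x \<in> {0<..} \<Longrightarrow> (deriv \<Phi> has_real_derivative D2 x) (at x)"
    by (rule C2_on_second_derivative[OF C2]) blast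
  have D1: "deriv \<Phi> 1 = K" using power[of 1] by simp
  have "((\<lambda>x. K * x powr \<alpha>) has_real_derivative K * \<alpha>) (at 1)"
    by (auto intro!: derivative_eq_intros)
  then have "(deriv \<Phi> has_real_derivative K * \<alpha>) (at 1)"
    by (rule has_field_derivative_transform_within_open[of _ _ _ "{0<..}"]) (auto simp: power)
  then have D21: "D2 1 = K * \<alpha>" using D2(2)[of 1] DERIV_unique by fastforce
  have v: "1 - 1 * D2 1 / deriv \<Phi> 1 = 1 - \<alpha>" using K by (simp add: D1 D21)
  have one: "(0::real) < 1" "deriv \<Phi> 1 < 0" using K D1 by auto
  have D2': "(deriv \<Phi> has_real_derivative D2 x) (at x)" if "x > 0" for x using D2(2) that by simp
  note freq = family_frequency[OF C2 V fam one D2(1) D2']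
  have Teq: "T = 2 * pi / sqrt (1 - \<alpha>)" using freq(2) \<alpha> v by simp
  define lam where "lam = - 1 / deriv \<Phi> 1"
  have lam: "lam > 0" using K by (simp add: lam_def D1)
  have lamD: "lam * deriv \<Phi> x = - (x powr \<alpha>)" if "x > 0" for x
    using K power[OF that] by (simp add: lam_def D1)
  define W where "W u = V lam (1 + u) - V lam 1" for u
  define f where "f u = (1 + u) - (1 + u) powr \<alpha>" for u :: real
  define A B where "A = - (\<alpha> * (\<alpha> - 1) / 2)" and "B = - (\<alpha> * (\<alpha> - 1) * (\<alpha> - 2) / 6)"
  have W': "(W has_real_derivative f u) (at u)" if "u > - 1" for u
  proof -
    have "(V lam has_real_derivative f u) (at (1 + u))"
      using family_derivative(1)[OF C2 V[OF lam], of "1 + u"] lamD[of "1 + u"] that by (simp add: f_def)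
    moreover have "((\<lambda>u. 1 + u) has_real_derivative 1) (at u)"
      by (auto intro!: derivative_eq_intros)
    ultimately have "((\<lambda>u. V lam (1 + u)) has_real_derivative f u * 1) (at u)"
      by (rule DERIV_chain2)
    then show ?thesis unfolding W_def by (auto intro!: derivative_eq_intros)
  qed
  have "10 * A\<^sup>2 = 9 * (sqrt (1 - \<alpha>))\<^sup>2 * B"
  proof (rule isochronous_second_order)
    show "sqrt (1 - \<alpha>) > 0" using \<alpha> by simp
    have "\<forall>\<^sub>F u in at (0::real). u \<in> {-1<..}" by (rule eventually_at_in_open') auto
    then show "\<forall>\<^sub>F u in at 0. (W has_real_derivative f u) (at u)"
      by eventually_elim (auto intro: W')
    show "(W \<longlongrightarrow> 0) (at 0)"
      using DERIV_isCont[OF W'[of 0]] by (simp add: isCont_def W_def)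
    have "((\<lambda>u. - (((1 + u) powr \<alpha> - 1 - \<alpha> * u - \<alpha> * (\<alpha> - 1) / 2 * u\<^sup>2) / u ^ 3)) \<longlongrightarrow> B) (at 0)"
      unfolding B_def by (intro tendsto_minus powr_expansion)
    moreover have "- (((1 + u) powr \<alpha> - 1 - \<alpha> * u - \<alpha> * (\<alpha> - 1) / 2 * u\<^sup>2) / u ^ 3) =
        (f u - (sqrt (1 - \<alpha>))\<^sup>2 * u - A * u\<^sup>2) / u ^ 3" for u
      unfolding minus_divide_left using \<alpha>
      by (intro arg_cong2[of _ _ _ _ "(/)"]) (simp_all add: f_def A_def algebra_simps)
    ultimately show "((\<lambda>u. (f u - (sqrt (1 - \<alpha>))\<^sup>2 * u - A * u\<^sup>2) / u ^ 3) \<longlongrightarrow> B) (at 0)"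
      by simp
  next
    fix \<epsilon> :: real assume "\<epsilon> > 0"
    then have "min \<epsilon> 1 > 0" by simp
    then have "\<exists>a b s. 1 - min \<epsilon> 1 < b \<and> b < 1 \<and> 1 < a \<and> a < 1 + min \<epsilon> 1 \<and> s > 0 \<and>
        V lam a - V lam 1 = s\<^sup>2 / 2 \<and> V lam b - V lam 1 = s\<^sup>2 / 2 \<and>
        s / (a - 1 / deriv \<Phi> 1 * deriv \<Phi> a) - s / (b - 1 / deriv \<Phi> 1 * deriv \<Phi> b) = T / pi"
      using freq(3)[of "min \<epsilon> 1"] \<alpha> v unfolding lam_def by simp
    then obtain a b s where abs: "1 - min \<epsilon> 1 < b" "b < 1" "1 < a" "a < 1 + min \<epsilon> 1" "s > 0"
        "V lam a - V lam 1 = s\<^sup>2 / 2" "V lam b - V lam 1 = s\<^sup>2 / 2"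
        "s / (a - 1 / deriv \<Phi> 1 * deriv \<Phi> a) - s / (b - 1 / deriv \<Phi> 1 * deriv \<Phi> b) = T / pi"
      by blast
    have pos: "a > 0" "b > 0" using abs by auto
    have "a - 1 / deriv \<Phi> 1 * deriv \<Phi> a = f (a - 1)" "b - 1 / deriv \<Phi> 1 * deriv \<Phi> b = f (b - 1)"
      using lamD[OF pos(1)] lamD[OF pos(2)] by (auto simp: f_def lam_def)
    then have "s / f (a - 1) - s / f (b - 1) = 2 / sqrt (1 - \<alpha>)"
      using abs(8) by (simp add: Teq)
    moreover have "- \<epsilon> < b - 1" "b - 1 < 0" "0 < a - 1" "a - 1 < \<epsilon>"
      using abs(1-4) by (auto simp: min_def split: if_splits)
    moreover have "W (a - 1) = s\<^sup>2 / 2" "W (b - 1) = s\<^sup>2 / 2" using abs(6,7) by (simp_all add: W_def)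
    ultimately show "\<exists>a b s. - \<epsilon> < b \<and> b < 0 \<and> 0 < a \<and> a < \<epsilon> \<and> s > 0 \<and>
        W a = s\<^sup>2 / 2 \<and> W b = s\<^sup>2 / 2 \<and> s / f a - s / f b = 2 / sqrt (1 - \<alpha>)"
      using abs(5) by blast
  qed
  then have "10 * A\<^sup>2 = 9 * (1 - \<alpha>) * B" using \<alpha> by simp
  moreover have "10 * A\<^sup>2 - 9 * (1 - \<alpha>) * B = (\<alpha> - 1)\<^sup>2 * (\<alpha> * (\<alpha> + 3))"
    unfolding A_def B_def by (simp add: field_simps power2_eq_square)
  ultimately have "(\<alpha> - 1)\<^sup>2 * (\<alpha> * (\<alpha> + 3)) = 0" by simp
  then have "\<alpha> = 0 \<or> \<alpha> = - 3" using \<alpha> by (auto simp: add_eq_0_iff2)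
  with Teq show ?thesis by simp
qed

lemma linear_family_isochronous:
  fixes \<Phi> :: "real \<Rightarrow> real" and V :: "real \<Rightarrow> real \<Rightarrow> real"
  assumes C2: "C2_on {0<..} \<Phi>"
    and V: "\<And>lam x. lam > 0 \<Longrightarrow> x > 0 \<Longrightarrow> V lam x = x\<^sup>2 / 2 + lam * \<Phi> x"
    and K: "K < 0" and \<Phi>': "\<And>x. x > 0 \<Longrightarrow> deriv \<Phi> x = K"
  shows "isochronous_family {0<..} (2 * pi) V"
  unfolding isochronous_family_def
proof (intro conjI allI impI)
  have V': "deriv (V lam) x = x - (- lam * K)" if "lam > 0" "x > 0" for lam x
    using family_derivative(2)[OF C2 V[OF that(1)] that(2)] \<Phi>'[OF that(2)] by simp
  have k: "- lam * K > 0" if "lam > 0" for lam using that K by (simp add: mult_pos_neg)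
  show "C2_on {0<..} (V lam)" if "lam > 0" for lam
    by (rule family_C2[OF C2 V[OF that]])
  show "x = y" if "lam > 0" "equilibrium {0<..} (V lam) x \<and> equilibrium {0<..} (V lam) y" for lam x y
    using that V'[OF that(1)] by (auto simp: equilibrium_def)
  show "isochronous_around {0<..} (2 * pi) (V lam) x" if "lam > 0" "equilibrium {0<..} (V lam) x" for lam x
  proof -
    have "x = - lam * K" using that V'[OF that(1)] by (auto simp: equilibrium_def)
    then show ?thesis using linear_potential_isochronous[OF V'[OF that(1)] k[OF that(1)]] by simp
  qed
  have "equilibrium {0<..} (V 1) (- 1 * K)" using V'[of 1] K by (simp add: equilibrium_def)
  then show "\<exists>lam>0. \<exists>x. equilibrium {0<..} (V lam) x" using zero_less_one by blast
qed

lemma inverse_square_family_isochronous: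
  fixes \<Phi> :: "real \<Rightarrow> real" and V :: "real \<Rightarrow> real \<Rightarrow> real"
  assumes C2: "C2_on {0<..} \<Phi>"
    and V: "\<And>lam x. lam > 0 \<Longrightarrow> x > 0 \<Longrightarrow> V lam x = x\<^sup>2 / 2 + lam * \<Phi> x"
    and K: "K < 0" and \<Phi>': "\<And>x. x > 0 \<Longrightarrow> deriv \<Phi> x = K / x ^ 3"
  shows "isochronous_family {0<..} pi V"
  unfolding isochronous_family_def
proof (intro conjI allI impI)
  have V': "deriv (V lam) x = x - (- lam * K) / x ^ 3" if "lam > 0" "x > 0" for lam x
    using family_derivative(2)[OF C2 V[OF that(1)] that(2)] \<Phi>'[OF that(2)] by simp
  have k: "- lam * K > 0" if "lam > 0" for lam using that K by (simp add: mult_pos_neg)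
  have eq: "x > 0 \<and> x ^ 4 = - lam * K" if "lam > 0" "equilibrium {0<..} (V lam) x" for lam x
  proof -
    have "x > 0" "x = (- lam * K) / x ^ 3" using that V'[OF that(1)] by (auto simp: equilibrium_def)
    then have "x * x ^ 3 = - lam * K" by (simp add: field_simps)
    then show ?thesis using \<open>x > 0\<close> by (simp add: eval_nat_numeral)
  qed
  show "C2_on {0<..} (V lam)" if "lam > 0" for lam
    by (rule family_C2[OF C2 V[OF that]])
  show "x = y" if "lam > 0" "equilibrium {0<..} (V lam) x \<and> equilibrium {0<..} (V lam) y" for lam x y
    using eq[OF that(1), of x] eq[OF that(1), of y] that power_eq_iff_eq_base[of 4 x y] by simp
  show "isochronous_around {0<..} pi (V lam) x" if "lam > 0" "equilibrium {0<..} (V lam) x" for lam x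
    using inverse_square_potential_isochronous[OF V'[OF that(1)] k[OF that(1)]] eq[OF that] by simp
  have "equilibrium {0<..} (V (- 1 / K)) 1"
    using V'[of "- 1 / K" 1] K by (simp add: equilibrium_def)
  then show "\<exists>lam>0. \<exists>x. equilibrium {0<..} (V lam) x" using K by (intro exI[of _ "- 1 / K"]) auto
qed

lemma antiderivative_on_half_line:
  fixes F G :: "real \<Rightarrow> real"
  assumes "\<And>x. x > 0 \<Longrightarrow> (F has_real_derivative h x) (at x)"
    and "\<And>x. x > 0 \<Longrightarrow> (G has_real_derivative h x) (at x)"
  obtains c where "\<And>x. x > 0 \<Longrightarrow> F x = G x + c"
proof -
  have "((\<lambda>x. F x - G x) has_real_derivative 0) (at x within {0<..})" if "x \<in> {0<..}" for x
    using DERIV_diff[OF assms(1)[of x] assms(2)[of x]] that by (simp add: has_field_derivative_at_within)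
  then obtain c where c: "\<And>x. x \<in> {0<..} \<Longrightarrow> F x - G x = c"
    using has_field_derivative_zero_constant[of "{0::real<..}" "\<lambda>x. F x - G x"] by auto
  show ?thesis
  proof (rule that[of c])
    fix x :: real assume "x > 0"
    then show "F x = G x + c" using c[of x] by simp
  qed
qed

lemma inverse_square_derivative:
  fixes x :: real
  assumes "x > 0"
  shows "((\<lambda>x. - (K / 2) * x powi (-2)) has_real_derivative K / x ^ 3) (at x)"
  using assms
  by (auto intro!: derivative_eq_intros simp: power_int_minus field_simps eval_nat_numeral)

section \<open>Classification of isochronous families\<close>

theorem theorem1p1:
  fixes \<Phi> :: "real \<Rightarrow> real" and V :: "real \<Rightarrow> real \<Rightarrow> real"
  assumes "C2_on {0<..} \<Phi>"
    and "\<And>lam x. lam > 0 \<Longrightarrow> x > 0 \<Longrightarrow> V lam x = x^2 / 2 + lam * \<Phi> x"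
  shows "((\<exists>T>0. isochronous_family {0<..} T V) \<longleftrightarrow>
            (\<exists>c. \<exists>K<0. (\<forall>x>0. \<Phi> x = K * x + c) \<or> (\<forall>x>0. \<Phi> x = - (K / 2) * x powi (-2) + c)))
       \<and> (\<forall>c. \<forall>K<0. (\<forall>x>0. \<Phi> x = K * x + c) \<longrightarrow>
            (\<forall>T>0. isochronous_family {0<..} T V \<longleftrightarrow> T = 2 * pi))
       \<and> (\<forall>c. \<forall>K<0. (\<forall>x>0. \<Phi> x = - (K / 2) * x powi (-2) + c) \<longrightarrow>
            (\<forall>T>0. isochronous_family {0<..} T V \<longleftrightarrow> T = pi))"
proof -
  note C2 = assms(1) and V = assms(2)
  have \<Phi>_deriv: "(\<Phi> has_real_derivative deriv \<Phi> x) (at x)" if "x > 0" for x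
    using C2 that by (simp add: C2_on_def DERIV_deriv_iff_real_differentiable)
  have lin': "deriv \<Phi> x = K" if "\<forall>x>0. \<Phi> x = K * x + c" "x > 0" for K c x
  proof (rule DERIV_imp_deriv)
    have "((\<lambda>x. K * x + c) has_real_derivative K) (at x)" by (auto intro!: derivative_eq_intros)
    then show "(\<Phi> has_real_derivative K) (at x)"
      by (rule has_field_derivative_transform_within_open[of _ _ _ "{0<..}"]) (use that in auto)
  qed
  have sq': "deriv \<Phi> x = K / x ^ 3" if "\<forall>x>0. \<Phi> x = - (K / 2) * x powi (-2) + c" "x > 0" for K c x
  proof (rule DERIV_imp_deriv)
    have "((\<lambda>x. - (K / 2) * x powi (-2) + c) has_real_derivative K / x ^ 3 + 0) (at x)"
      by (intro DERIV_add inverse_square_derivative DERIV_const that(2))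
    then show "(\<Phi> has_real_derivative K / x ^ 3) (at x)"
      by (intro has_field_derivative_transform_within_open[of _ _ _ "{0<..}" \<Phi>]) (use that in auto)
  qed
  have cube: "x powr (- 3) = 1 / x ^ 3" if "x > 0" for x :: real
    using that powr_realpow[of x 3] by (simp add: powr_minus_divide)
  have lin: "isochronous_family {0<..} T V \<longleftrightarrow> T = 2 * pi"
    if lin: "\<forall>x>0. \<Phi> x = K * x + c" and K: "K < 0" for K c T
  proof
    assume "isochronous_family {0<..} T V"
    from isochronous_power_exponent[OF C2 V this _ K, of 0] show "T = 2 * pi"
      using lin'[OF lin] by simp
  next
    assume "T = 2 * pi"
    then show "isochronous_family {0<..} T V"
      using linear_family_isochronous[OF C2 V K lin'[OF lin]] by simp
  qed
  have sq: "isochronous_family {0<..} T V \<longleftrightarrow> T = pi"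
    if sq: "\<forall>x>0. \<Phi> x = - (K / 2) * x powi (-2) + c" and K: "K < 0" for K c T
  proof
    assume "isochronous_family {0<..} T V"
    from isochronous_power_exponent[OF C2 V this _ K, of "- 3"] show "T = pi"
      using sq'[OF sq] cube by simp
  next
    assume "T = pi"
    then show "isochronous_family {0<..} T V"
      using inverse_square_family_isochronous[OF C2 V K sq'[OF sq]] by simp
  qed
  have "\<exists>c. \<exists>K<0. (\<forall>x>0. \<Phi> x = K * x + c) \<or> (\<forall>x>0. \<Phi> x = - (K / 2) * x powi (-2) + c)"
    if T: "T > 0" and fam: "isochronous_family {0<..} T V" for T
  proof -
    obtain K where K: "K < 0" and power: "\<And>x. x > 0 \<Longrightarrow> deriv \<Phi> x = K * x powr (1 - (2 * pi / T)\<^sup>2)"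
      using isochronous_family_power_law[OF C2 V fam T] by blast
    have "1 - (2 * pi / T)\<^sup>2 < 1" using T by simp
    from isochronous_power_exponent[OF C2 V fam this K power]
    consider "1 - (2 * pi / T)\<^sup>2 = 0" | "1 - (2 * pi / T)\<^sup>2 = - 3" by blast
    then show ?thesis
    proof cases
      case 1
      have "((\<lambda>x. K * x) has_real_derivative deriv \<Phi> x) (at x)" if "x > 0" for x
        using power[OF that] that unfolding 1 by (auto intro!: derivative_eq_intros)
      from antiderivative_on_half_line[OF \<Phi>_deriv this] obtain c
        where "\<And>x. x > 0 \<Longrightarrow> \<Phi> x = K * x + c" by blast
      then show ?thesis using K by blast
    next
      case 2
      have "((\<lambda>x. - (K / 2) * x powi (-2)) has_real_derivative deriv \<Phi> x) (at x)" if "x > 0" for x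
        using inverse_square_derivative[OF that, of K] power[OF that] cube[OF that] unfolding 2 by simp
      from antiderivative_on_half_line[OF \<Phi>_deriv this] obtain c
        where "\<And>x. x > 0 \<Longrightarrow> \<Phi> x = - (K / 2) * x powi (-2) + c" by blast
      then show ?thesis using K by blast
    qed
  qed
  moreover have "\<exists>T>0. isochronous_family {0<..} T V"
    if "K < 0" "(\<forall>x>0. \<Phi> x = K * x + c) \<or> (\<forall>x>0. \<Phi> x = - (K / 2) * x powi (-2) + c)" for c K
    using that(2)
  proof
    assume "\<forall>x>0. \<Phi> x = K * x + c"
    then show ?thesis using lin[of K c "2 * pi"] that(1) by (intro exI[of _ "2 * pi"]) simp
  next
    assume "\<forall>x>0. \<Phi> x = - (K / 2) * x powi (-2) + c"
    then show ?thesis using sq[of K c pi] that(1) by (intro exI[of _ pi]) simp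
  qed
  ultimately show ?thesis using lin sq by blast
qed

end
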